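(* Let $\kappa$ be an uncountable regular cardinal with the property that $\square(\kappa)$ holds. If $\lambda<\kappa$ is an infinite regular cardinal, then there is a partial order $\mathbb{P}$ with the following properties: (1) If $\mu<\lambda$ is a (possibly finite) cardinal with $\nu^\mu<\kappa$ for all $\nu<\kappa$, then $\mathbb{P}^\mu$ is $\kappa$-Knaster. (2) $\mathbb{P}^\lambda$ does not satisfy the $\kappa$-chain condition.
   Context: For a set $A$ of ordinals, $\mathrm{acc}(A)$ is the set of $\alpha\in A$ with $\alpha>0$ and $\sup(A\cap\alpha)=\alpha$; so $\mathrm{acc}(\kappa)$ is the set of nonzero limit ordinals below $\kappa$. $\square(\kappa)$: there is a $\square(\kappa)$-sequence, i.e. a sequence $\langle C_\alpha\mid\alpha<\kappa\rangle$ such that (1) for all $\alpha\in\mathrm{acc}(\kappa)$, $C_\alpha$ is a club subset of $\alpha$; (2) if $\alpha,\beta\in\mathrm{acc}(\kappa)$ and $\alpha\in\mathrm{acc}(C_\beta)$, then $C_\alpha=C_\beta\cap\alpha$; (3) there is no club $D$ in $\kappa$ such that $D\cap\alpha=C_\alpha$ for all $\alpha\in\mathrm{acc}(D)$. (Entries at non-limit indices are irrelevant.) For a cardinal $\theta$, $\mathbb{P}^\theta$ is the full-support product of $\theta$ copies of $\mathbb{P}$. A partial order is $\kappa$-Knaster if every collection of $\kappa$-many conditions contains a subcollection of cardinality $\kappa$ consisting of pairwise compatible conditions. It satisfies the $\kappa$-chain condition if it has no antichain (set of pairwise incompatible conditions) of cardinality $\kappa$. *)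

theory Defs
  imports Main
begin

unbundle cardinal_syntax

text \<open>
  A cardinal \<open>\<kappa>\<close> is a relation satisfying \<^term>\<open>Card_order\<close>, i.e. an initial well-order.
  The ordinals below \<open>\<kappa>\<close> are the elements of \<^term>\<open>Field \<kappa>\<close>. In the von Neumann style,
  an ordinal \<open>\<alpha> < \<kappa>\<close>, regarded as a set, is \<^term>\<open>underS \<kappa> \<alpha>\<close>, and \<open>\<kappa>\<close> itself, regarded
  as a set, is \<^term>\<open>Field \<kappa>\<close>.
\<close>

definition limit_of :: "'a rel \<Rightarrow> 'a set \<Rightarrow> 'a \<Rightarrow> bool" where
  \<comment> \<open>\<open>\<alpha> > 0\<close> and \<open>sup (A \<inter> \<alpha>) = \<alpha>\<close>\<close>
  "limit_of \<kappa> A \<alpha> \<longleftrightarrow>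
     underS \<kappa> \<alpha> \<noteq> {} \<and> wo_rel.supr \<kappa> (A \<inter> underS \<kappa> \<alpha>) = \<alpha>"

definition acc :: "'a rel \<Rightarrow> 'a set \<Rightarrow> 'a set" where
  "acc \<kappa> A = {\<alpha> \<in> A. limit_of \<kappa> A \<alpha>}"

text \<open>
  In \<open>club_in \<kappa> \<delta> C\<close> the ordinal \<open>\<delta> \<le> \<kappa>\<close> is given as a set: \<open>\<delta>\<close> is \<^term>\<open>Field \<kappa>\<close> or
  \<open>underS \<kappa> \<alpha>\<close> for some \<open>\<alpha>\<close>.
\<close>

definition club_in :: "'a rel \<Rightarrow> 'a set \<Rightarrow> 'a set \<Rightarrow> bool" where
  "club_in \<kappa> \<delta> C \<longleftrightarrow>
     C \<subseteq> \<delta> \<and>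
     (\<forall>\<beta>\<in>\<delta>. \<exists>\<gamma>\<in>C. (\<beta>, \<gamma>) \<in> \<kappa>) \<and>
     (\<forall>\<beta>\<in>\<delta>. limit_of \<kappa> C \<beta> \<longrightarrow> \<beta> \<in> C)"

definition square_seq :: "'a rel \<Rightarrow> ('a \<Rightarrow> 'a set) \<Rightarrow> bool" where
  "square_seq \<kappa> C \<longleftrightarrow>
     (\<forall>\<alpha> \<in> acc \<kappa> (Field \<kappa>). club_in \<kappa> (underS \<kappa> \<alpha>) (C \<alpha>)) \<and>
     (\<forall>\<alpha> \<in> acc \<kappa> (Field \<kappa>). \<forall>\<beta> \<in> acc \<kappa> (Field \<kappa>).
        \<alpha> \<in> acc \<kappa> (C \<beta>) \<longrightarrow> C \<alpha> = C \<beta> \<inter> underS \<kappa> \<alpha>) \<and>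
     \<not> (\<exists>D. club_in \<kappa> (Field \<kappa>) D \<and> (\<forall>\<alpha> \<in> acc \<kappa> D. D \<inter> underS \<kappa> \<alpha> = C \<alpha>))"

definition square :: "'a rel \<Rightarrow> bool" where
  "square \<kappa> \<longleftrightarrow> (\<exists>C. square_seq \<kappa> C)"

text \<open>
  Partial orders are relations \<open>P\<close> with \<^term>\<open>Partial_order P\<close> (library); the conditions are
  the elements of \<^term>\<open>Field P\<close>, and \<open>(p, q) \<in> P\<close> means \<open>p \<le> q\<close>, i.e. \<open>p\<close> is stronger than \<open>q\<close>.
  An existential claim about partial orders has to name a carrier type. For the properties below,
  with \<open>\<kappa> :: 'a rel\<close>, the type \<^typ>\<open>'a set\<close> is large enough: closing off \<open>\<kappa>\<close> many conditions
  under witnesses of compatibility gives a suborder with at most \<open>\<kappa>\<close> conditions and the same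
  compatibility relation.
\<close>

definition compatible :: "'p rel \<Rightarrow> 'p \<Rightarrow> 'p \<Rightarrow> bool" where
  "compatible P p q \<longleftrightarrow> (\<exists>r \<in> Field P. (r, p) \<in> P \<and> (r, q) \<in> P)"

definition knaster :: "'k rel \<Rightarrow> 'p rel \<Rightarrow> bool" where
  "knaster \<kappa> P \<longleftrightarrow>
     (\<forall>A \<subseteq> Field P. |A| =o \<kappa> \<longrightarrow> (\<exists>B \<subseteq> A. |B| =o \<kappa> \<and> pairwise (compatible P) B))"

definition chain_condition :: "'k rel \<Rightarrow> 'p rel \<Rightarrow> bool" where
  "chain_condition \<kappa> P \<longleftrightarrow>
     \<not> (\<exists>A \<subseteq> Field P. |A| =o \<kappa> \<and> pairwise (\<lambda>p q. \<not> compatible P p q) A)"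

text \<open>
  The full-support power \<open>P\<^sup>\<theta>\<close>. Its conditions are all functions from \<^term>\<open>Field \<theta>\<close> to
  \<^term>\<open>Field P\<close> (\<^term>\<open>Func\<close> fixes the irrelevant values outside \<^term>\<open>Field \<theta>\<close>, so that
  equality is the right one); the order is coordinatewise.
\<close>

definition full_power :: "'p rel \<Rightarrow> 'i rel \<Rightarrow> ('i \<Rightarrow> 'p) rel" where
  "full_power P \<theta> =
     {(f, g). f \<in> Func (Field \<theta>) (Field P) \<and> g \<in> Func (Field \<theta>) (Field P) \<and>
              (\<forall>i \<in> Field \<theta>. (f i, g i) \<in> P)}"

end

theory Submission
  imports Defs
begin

text \<open>
  The forcing is assembled from \<open>\<lambda>\<close> many tree orders on \<open>\<kappa>\<close>. From a \<open>\<square>(\<kappa>)\<close>-sequence one gets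
  relations \<open>below i\<close> (\<open>i < \<lambda>\<close>), each a tree order contained in the ordering of \<open>\<kappa>\<close> and
  increasing with \<open>i\<close>, such that any two ordinals below \<open>\<kappa>\<close> are comparable in \<open>below i\<close> for large
  \<open>i\<close> (lemma \<open>below_exhaustive\<close>), while no single \<open>below i\<close> has an unbounded chain (lemma
  \<open>no_unbounded_chain\<close>). A condition is a finite set of pairs \<open>(i, \<alpha>)\<close> whose \<open>i\<close>-th section is
  an antichain of \<open>below i\<close> for every \<open>i\<close>, and conditions are ordered by reverse inclusion.

  In the power with \<open>\<lambda>\<close> coordinates the sequences \<open>i \<mapsto> {(i, \<alpha>)}\<close>, for \<open>\<alpha> < \<kappa>\<close>, are
  pairwise incompatible: \<open>\<alpha>\<close> and \<open>\<beta>\<close> clash at every coordinate \<open>i\<close> at which they are comparable.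

  A condition of a power with \<open>\<mu> < \<lambda>\<close> coordinates mentions fewer than \<open>\<lambda>\<close> pairs. Hence its
  indices are bounded by some \<open>i < \<lambda>\<close>, and as the trees increase, every incompatibility shows up as
  a comparability in the one tree \<open>below i\<close>. Let \<open>\<kappa>\<close> many conditions be indexed by ordinals \<open>\<gamma>\<close>
  of cofinality at least \<open>\<lambda>\<close>. Fodor's lemma and the hypothesis on \<open>\<nu>\<^sup>\<mu>\<close> give a stationary set
  of \<open>\<gamma>\<close> for which \<open>i\<close> and the part of the condition below \<open>\<gamma>\<close> are constant. What remains at
  \<open>\<gamma>\<close> is a set \<open>a \<gamma>\<close> of fewer than \<open>\<lambda>\<close> ordinals, none below \<open>\<gamma>\<close>, and the family of these sets
  can be thinned out until members of different sets are incomparable (lemma \<open>separated_subfamily\<close>). The trees are closed under limits, so an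
  ordinal above \<open>\<gamma>\<close> that does not lie above \<open>\<gamma>\<close> in the tree has its ancestors below \<open>\<gamma>\<close> bounded
  in \<open>\<gamma>\<close>, and the cofinality of \<open>\<gamma>\<close> yields one bound for fewer than \<open>\<lambda>\<close> such ordinals. If for
  stationarily many \<open>\<gamma>\<close> some later \<open>a \<xi>\<close> avoids \<open>\<gamma>\<close> and the tree above it, pressing this bound down
  makes those \<open>a \<xi>\<close> incomparable; otherwise pressing it down makes stationarily many \<open>\<gamma>\<close> an
  unbounded chain, which is impossible.

  The trees come from a \<open>\<square>(\<kappa>)\<close>-sequence \<open>C\<close> together with a colouring \<open>h\<close> of \<open>\<kappa>\<close> by elements of
  \<open>\<lambda>\<close> which is constant along the branches of \<open>C\<close> and for which each set \<open>{\<alpha>. i < h \<alpha>}\<close> is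
  stationary. The \<open>i\<close>-th tree uses only ordinals \<open>\<alpha>\<close> with \<open>h \<alpha> \<le> i\<close>; a limit of an unbounded
  chain would have to obey this too, but some such limit \<open>\<gamma>\<close> has \<open>h \<gamma> > i\<close>. The colouring exists
  because \<open>C\<close> has no thread (lemma \<open>branches_split\<close>): any stationary set of limit ordinals \<open>\<alpha>\<close>
  disagrees stationarily often with any prescribed value of \<open>C \<alpha> \<inter> \<gamma>\<close>, once \<open>\<gamma>\<close> is large.
  Following one branch \<open>d\<close> through \<open>\<lambda>\<close> many such \<open>\<gamma>\<close>, let \<open>h \<alpha>\<close> be the stage at which \<open>C \<alpha>\<close>
  leaves \<open>d\<close>.
\<close>

section \<open>Regular cardinals and stationary sets\<close>

text \<open>
  An infinite regular cardinal is represented by an initial segment \<open>K\<close> of a well-order of the whole type, so that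
  the order facts hold without membership side conditions and only closure properties speak of \<open>K\<close>.
\<close>

locale regular_cardinal = wellorder le lt
  for le :: "'a \<Rightarrow> 'a \<Rightarrow> bool" (infix \<open>\<sqsubseteq>\<close> 50) and lt :: "'a \<Rightarrow> 'a \<Rightarrow> bool" (infix \<open>\<sqsubset>\<close> 50) +
  fixes K :: "'a set"
  assumes downward: "x \<in> K \<Longrightarrow> y \<sqsubset> x \<Longrightarrow> y \<in> K"
    and segment_small: "x \<in> K \<Longrightarrow> |{y. y \<sqsubset> x}| <o |K|"
    and stable_K: "stable |K|"
    and infinite_K: "infinite K"
begin

lemma downward_eq: "x \<in> K \<Longrightarrow> y \<sqsubseteq> x \<Longrightarrow> y \<in> K"
  using downward[of x y] by (auto simp: le_less)

lemma least_witness: "P x \<Longrightarrow> \<exists>m. P m \<and> (\<forall>y. y \<sqsubset> m \<longrightarrow> \<not> P y)"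
proof (induction x rule: less_induct)
  case (less x)
  show ?case
  proof (cases "\<exists>y. y \<sqsubset> x \<and> P y")
    case True
    then show ?thesis
      using less.IH by blast
  next
    case False
    then show ?thesis
      using less.prems by blast
  qed
qed

lemma small_UN:
  "|I| <o |K| \<Longrightarrow> (\<And>i. i \<in> I \<Longrightarrow> |A i| <o |K| ) \<Longrightarrow> |\<Union>i\<in>I. A i| <o |K|"
  using stable_K stable_UNION by blast

lemma small_finite: "finite X \<Longrightarrow> |X| <o |K|"
  using infinite_K by (meson card_of_Well_order card_of_ordLeq_finite not_ordLeq_iff_ordLess)

lemma small_subset: "X \<subseteq> Y \<Longrightarrow> |Y| <o |K| \<Longrightarrow> |X| <o |K|"
  using card_of_mono1 ordLeq_ordLess_trans by blast

lemma small_image: "|X| <o |K| \<Longrightarrow> |f ` X| <o |K|"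
  using card_of_image ordLeq_ordLess_trans by blast

lemma small_Un: "|X| <o |K| \<Longrightarrow> |Y| <o |K| \<Longrightarrow> |X \<union> Y| <o |K|"
  using infinite_K card_of_Un_ordLess_infinite by blast

lemma segment_eq_small: "x \<in> K \<Longrightarrow> |{y. y \<sqsubseteq> x}| <o |K|"
  using small_Un[OF segment_small[of x] small_finite[of "{x}"]] 
  by (rule_tac small_subset[of _ "{y. y \<sqsubset> x} \<union> {x}"]) (auto simp: le_less)

lemma small_bounded:
  assumes "X \<subseteq> K" "|X| <o |K|"
  shows "\<exists>b\<in>K. \<forall>x\<in>X. x \<sqsubset> b"
proof (rule ccontr)
  assume "\<not> ?thesis"
  then have "K \<subseteq> (\<Union>x\<in>X. {y. y \<sqsubseteq> x})"
    by (auto simp: not_less)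
  moreover have "|\<Union>x\<in>X. {y. y \<sqsubseteq> x}| <o |K|"
    using assms segment_eq_small by (intro small_UN) auto
  ultimately have "|K| <o |K|"
    using small_subset by blast
  then show False
    by (simp add: ordLess_irreflexive)
qed

lemma family_bounded:
  assumes "|I| <o |K|" "\<And>i. i \<in> I \<Longrightarrow> f i \<in> K"
  shows "\<exists>b\<in>K. \<forall>i\<in>I. f i \<sqsubset> b"
  using small_bounded[of "f ` I"] small_image[OF assms(1), of f] assms(2) by auto

lemma no_greatest: "x \<in> K \<Longrightarrow> \<exists>y\<in>K. x \<sqsubset> y"
  using small_bounded[of "{x}"] small_finite[of "{x}"] by auto

lemma pair_bounded: "x \<in> K \<Longrightarrow> y \<in> K \<Longrightarrow> \<exists>z\<in>K. x \<sqsubset> z \<and> y \<sqsubset> z"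
  using small_bounded[of "{x, y}"] small_finite[of "{x, y}"] by auto

lemma unbounded_card:
  assumes "X \<subseteq> K" "\<And>b. b \<in> K \<Longrightarrow> \<exists>x\<in>X. b \<sqsubseteq> x"
  shows "|X| =o |K|"
proof -
  have "\<not> |X| <o |K|"
    using small_bounded[OF assms(1)] assms(2) by (meson not_less)
  moreover have "|X| \<le>o |K|"
    using assms(1) by (rule card_of_mono1)
  ultimately show ?thesis
    using ordLeq_iff_ordLess_or_ordIso by blast
qed

text \<open>
  In von Neumann terms: \<open>\<gamma> > 0\<close> and \<open>sup (X \<inter> \<gamma>) = \<gamma>\<close>.
\<close>

definition limit_point :: "'a set \<Rightarrow> 'a \<Rightarrow> bool" where
  "limit_point X \<gamma> \<longleftrightarrow> (\<exists>x. x \<sqsubset> \<gamma>) \<and> (\<forall>x. x \<sqsubset> \<gamma> \<longrightarrow> (\<exists>y\<in>X. x \<sqsubset> y \<and> y \<sqsubset> \<gamma>))"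

abbreviation is_limit :: "'a \<Rightarrow> bool" where
  "is_limit \<equiv> limit_point UNIV"

definition closed_under :: "('a \<Rightarrow> 'a) \<Rightarrow> 'a \<Rightarrow> bool" where
  "closed_under f \<gamma> \<longleftrightarrow> (\<exists>x. x \<sqsubset> \<gamma>) \<and> (\<forall>x. x \<sqsubset> \<gamma> \<longrightarrow> f x \<sqsubset> \<gamma>)"

text \<open>
  For a regular uncountable cardinal every club contains the closure points of some function and the closure
  points of a function form a club, so meeting every set of closure points is the usual notion of
  stationarity. In this form the intersection of a small family of clubs, and the diagonal intersection,
  become a pointwise bound on the functions involved.
\<close>

definition stationary :: "'a set \<Rightarrow> bool" where
  "stationary S \<longleftrightarrow> S \<subseteq> K \<and> (\<forall>f. f ` K \<subseteq> K \<longrightarrow> (\<exists>x\<in>S. closed_under f x))"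

lemma limit_point_mono: "limit_point X \<gamma> \<Longrightarrow> X \<subseteq> Y \<Longrightarrow> limit_point Y \<gamma>"
  unfolding limit_point_def by blast

lemma stationary_subset: "stationary S \<Longrightarrow> S \<subseteq> K"
  by (simp add: stationary_def)

lemma stationary_mono: "stationary S \<Longrightarrow> S \<subseteq> T \<Longrightarrow> T \<subseteq> K \<Longrightarrow> stationary T"
  unfolding stationary_def by blast

lemma closed_under_mono:
  assumes "closed_under g x" "\<And>y. y \<sqsubset> x \<Longrightarrow> f y \<sqsubseteq> g y"
  shows "closed_under f x"
  using assms unfolding closed_under_def by (blast intro: le_less_trans)

lemma stationary_closed:
  assumes S: "stationary S" and f: "f ` K \<subseteq> K"
  shows "stationary {x\<in>S. closed_under f x}"
  unfolding stationary_def
proof (intro conjI allI impI)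
  show "{x\<in>S. closed_under f x} \<subseteq> K"
    using stationary_subset[OF S] by blast
  fix g assume g: "g ` K \<subseteq> K"
  define m where "m x = (if f x \<sqsubseteq> g x then g x else f x)" for x
  have "m ` K \<subseteq> K"
    using f g by (auto simp: m_def)
  then obtain x where x: "x \<in> S" "closed_under m x"
    using S unfolding stationary_def by blast
  have "f y \<sqsubseteq> m y" "g y \<sqsubseteq> m y" for y
    using le_less_linear[of "f y" "g y"] by (auto simp: m_def less_imp_le)
  then have "closed_under f x" "closed_under g x"
    using x closed_under_mono by blast+
  then show "\<exists>x\<in>{x \<in> S. closed_under f x}. closed_under g x"
    using x by blast
qed

lemma stationary_above:
  assumes "stationary S" "b \<in> K"
  shows "stationary {x\<in>S. b \<sqsubset> x}"
proof -
  have "stationary {x\<in>S. closed_under (\<lambda>_. b) x}"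
    using assms by (intro stationary_closed) auto
  then show ?thesis
    by (rule stationary_mono) (use stationary_subset[OF assms(1)] in \<open>auto simp: closed_under_def\<close>)
qed

lemma stationary_unbounded: "stationary S \<Longrightarrow> b \<in> K \<Longrightarrow> \<exists>x\<in>S. b \<sqsubset> x"
  using stationary_above[of S b] unfolding stationary_def by fastforce

lemma limit_of_closed:
  assumes "x \<in> K" "\<And>y. y \<in> K \<Longrightarrow> f y \<in> X \<and> y \<sqsubset> f y" "closed_under f x"
  shows "limit_point X x"
proof -
  have "f y \<in> X \<and> y \<sqsubset> f y" if "y \<sqsubset> x" for y
    using assms(2) downward[OF assms(1) that] by blast
  then show ?thesis
    using assms(3) unfolding limit_point_def closed_under_def by blast
qed

lemma stationary_limits:
  assumes S: "stationary S" and X: "X \<subseteq> K" "\<And>y. y \<in> K \<Longrightarrow> \<exists>z\<in>X. y \<sqsubset> z"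
  shows "stationary {x\<in>S. limit_point X x}"
proof -
  obtain f where f: "\<And>y. y \<in> K \<Longrightarrow> f y \<in> X \<and> y \<sqsubset> f y"
    using X(2) by metis
  have "stationary {x\<in>S. closed_under f x}"
    using f X(1) by (intro stationary_closed S) auto
  then show ?thesis
    by (rule stationary_mono) (use stationary_subset[OF S] limit_of_closed f in auto)
qed

lemma nonstationary_fibre:
  assumes "stationary S" "\<not> stationary {x\<in>S. P x}"
  shows "\<exists>g. g ` K \<subseteq> K \<and> (\<forall>x\<in>S. P x \<longrightarrow> \<not> closed_under g x)"
proof -
  have "{x\<in>S. P x} \<subseteq> K"
    using stationary_subset[OF assms(1)] by blast
  then obtain g where "g ` K \<subseteq> K" "\<not> (\<exists>x\<in>{x\<in>S. P x}. closed_under g x)"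
    using assms(2) unfolding stationary_def by blast
  then show ?thesis
    by blast
qed

text \<open>
  Witnesses for the nonstationarity of all the fibres would be dominated pointwise by a single function, since
  there are fewer than \<open>|K|\<close> of them; its closure points in \<open>S\<close> then belong to no fibre.
\<close>

lemma stationary_partition:
  assumes S: "stationary S" and W: "|W| <o |K|" and f: "\<And>x. x \<in> S \<Longrightarrow> f x \<in> W"
  shows "\<exists>w\<in>W. stationary {x\<in>S. f x = w}"
proof (rule ccontr)
  assume "\<not> ?thesis"
  then have "\<forall>w\<in>W. \<exists>g. g ` K \<subseteq> K \<and> (\<forall>x\<in>S. f x = w \<longrightarrow> \<not> closed_under g x)"
    using nonstationary_fibre[OF S] by simp
  then obtain g where
    "\<forall>w\<in>W. g w ` K \<subseteq> K \<and> (\<forall>x\<in>S. f x = w \<longrightarrow> \<not> closed_under (g w) x)"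
    using bchoice[of W "\<lambda>w g. g ` K \<subseteq> K \<and> (\<forall>x\<in>S. f x = w \<longrightarrow> \<not> closed_under g x)"] by blast
  then have g: "\<And>w. w \<in> W \<Longrightarrow> g w ` K \<subseteq> K"
    "\<And>w x. w \<in> W \<Longrightarrow> x \<in> S \<Longrightarrow> f x = w \<Longrightarrow> \<not> closed_under (g w) x"
    by auto
  have "\<exists>b\<in>K. \<forall>w\<in>W. g w y \<sqsubset> b" if "y \<in> K" for y
    using that g(1) by (intro family_bounded W) auto
  then obtain F where F: "\<And>y. y \<in> K \<Longrightarrow> F y \<in> K" "\<And>y w. y \<in> K \<Longrightarrow> w \<in> W \<Longrightarrow> g w y \<sqsubset> F y"
    by metis
  then obtain x where x: "x \<in> S" "closed_under F x"
    using S unfolding stationary_def by blast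
  have "y \<in> K" if "y \<sqsubset> x" for y
    using downward[OF _ that] x(1) stationary_subset[OF S] by blast
  then have "closed_under (g (f x)) x"
    using F(2)[OF _ f[OF x(1)]] less_imp_le by (intro closed_under_mono[OF x(2)]) blast
  then show False
    using g(2) x(1) f by blast
qed

lemma stationary_split:
  assumes "stationary S"
  shows "stationary {x\<in>S. P x} \<or> stationary {x\<in>S. \<not> P x}"
  using stationary_partition[OF assms, of "{True, False}" P] small_finite[of "{True, False}"] by auto

text \<open>
  The diagonal intersection is coded by the function \<open>F y\<close> that bounds \<open>g w v\<close> for all \<open>w, v \<sqsubseteq> y\<close>: a
  closure point \<open>x\<close> of \<open>F\<close> is a closure point of each \<open>g w\<close> with \<open>w \<sqsubset> x\<close>, in particular of \<open>g (f x)\<close>.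
\<close>

lemma fodor:
  assumes S: "stationary S" and f: "\<And>x. x \<in> S \<Longrightarrow> f x \<sqsubset> x"
  shows "\<exists>c\<in>K. stationary {x\<in>S. f x = c}"
proof (rule ccontr)
  assume "\<not> ?thesis"
  then have "\<forall>w\<in>K. \<exists>g. g ` K \<subseteq> K \<and> (\<forall>x\<in>S. f x = w \<longrightarrow> \<not> closed_under g x)"
    using nonstationary_fibre[OF S] by simp
  then obtain g where
    "\<forall>w\<in>K. g w ` K \<subseteq> K \<and> (\<forall>x\<in>S. f x = w \<longrightarrow> \<not> closed_under (g w) x)"
    using bchoice[of K "\<lambda>w g. g ` K \<subseteq> K \<and> (\<forall>x\<in>S. f x = w \<longrightarrow> \<not> closed_under g x)"] by blast
  then have g: "\<And>w. w \<in> K \<Longrightarrow> g w ` K \<subseteq> K"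
    "\<And>w x. w \<in> K \<Longrightarrow> x \<in> S \<Longrightarrow> f x = w \<Longrightarrow> \<not> closed_under (g w) x"
    by auto
  have "\<exists>b\<in>K. \<forall>w\<in>{w. w \<sqsubseteq> y}. \<forall>v\<in>{v. v \<sqsubseteq> y}. g w v \<sqsubset> b" if y: "y \<in> K" for y
  proof -
    have "\<exists>b\<in>K. \<forall>v\<in>{v. v \<sqsubseteq> y}. g w v \<sqsubset> b" if "w \<sqsubseteq> y" for w
      using that y g(1)[of w] downward_eq[OF y] by (intro family_bounded segment_eq_small) auto
    then obtain h where h: "\<And>w. w \<sqsubseteq> y \<Longrightarrow> h w \<in> K \<and> (\<forall>v\<in>{v. v \<sqsubseteq> y}. g w v \<sqsubset> h w)"
      by metis
    have "\<exists>b\<in>K. \<forall>w\<in>{w. w \<sqsubseteq> y}. h w \<sqsubset> b"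
      using y h by (intro family_bounded segment_eq_small) auto
    then show ?thesis
      using h less_trans by blast
  qed
  then obtain F where F: "\<And>y. y \<in> K \<Longrightarrow> F y \<in> K"
    "\<And>y w v. y \<in> K \<Longrightarrow> w \<sqsubseteq> y \<Longrightarrow> v \<sqsubseteq> y \<Longrightarrow> g w v \<sqsubset> F y"
    by (metis mem_Collect_eq)
  then obtain x where x: "x \<in> S" "closed_under F x"
    using S unfolding stationary_def by blast
  have xK: "x \<in> K"
    using x stationary_subset[OF S] by blast
  have "g (f x) y \<sqsubset> x" if "y \<sqsubset> x" for y
  proof (cases "y \<sqsubseteq> f x")
    case True
    then show ?thesis
      using F(2)[of "f x" "f x" y] x(2) f[OF x(1)] downward[OF xK] order_refl[of "f x"] less_trans
      unfolding closed_under_def by blast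
  next
    case False
    then show ?thesis
      using F(2)[of y "f x" y] x(2) that downward[OF xK that] less_trans order_refl[of y] not_le less_imp_le
      unfolding closed_under_def by metis
  qed
  then have "closed_under (g (f x)) x"
    using x(2) by (simp add: closed_under_def)
  then show False
    using g(2)[OF downward[OF xK f[OF x(1)]] x(1)] by blast
qed

end

locale two_regular_cardinals = regular_cardinal le lt K + L: regular_cardinal leL ltL L
  for le :: "'a \<Rightarrow> 'a \<Rightarrow> bool" (infix \<open>\<sqsubseteq>\<close> 50) and lt :: "'a \<Rightarrow> 'a \<Rightarrow> bool" (infix \<open>\<sqsubset>\<close> 50)
    and K :: "'a set"
    and leL :: "'b \<Rightarrow> 'b \<Rightarrow> bool" (infix \<open>\<preceq>\<close> 50) and ltL :: "'b \<Rightarrow> 'b \<Rightarrow> bool" (infix \<open>\<prec>\<close> 50)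
    and L :: "'b set" +
  assumes L_less_K: "|L| <o |K|"
begin

text \<open>
  The ordinal \<open>\<gamma>\<close> has cofinality at least \<open>|L|\<close>. The bound \<open>b\<close> is strict, so that the instances
  \<open>X = {}\<close> and \<open>X = {x}\<close> make \<open>\<gamma>\<close> a nonzero limit.
\<close>

definition large_cof :: "'a \<Rightarrow> bool" where
  "large_cof \<gamma> \<longleftrightarrow> (\<forall>X. X \<subseteq> {y. y \<sqsubset> \<gamma>} \<longrightarrow> |X| <o |L| \<longrightarrow> (\<exists>b. b \<sqsubset> \<gamma> \<and> (\<forall>x\<in>X. x \<sqsubset> b)))"

text \<open>
  A sequence of length \<open>L\<close> that climbs past the values of \<open>f\<close>, so that its supremum is a closure point of
  \<open>f\<close>; at each stage fewer than \<open>|K|\<close> requirements have to be met.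
\<close>

lemma increasing_sequence:
  assumes f: "f ` K \<subseteq> K"
  shows "\<exists>g. (\<forall>j\<in>L. g j \<in> K) \<and>
    (\<forall>j\<in>L. \<forall>k. k \<prec> j \<longrightarrow> g k \<sqsubset> g j \<and> (\<forall>y. y \<sqsubseteq> g k \<longrightarrow> f y \<sqsubset> g j))"
proof -
  define Q where "Q g j r \<longleftrightarrow> (j \<in> L \<longrightarrow> r \<in> K \<and>
    (\<forall>k. k \<prec> j \<longrightarrow> g k \<sqsubset> r \<and> (\<forall>y. y \<sqsubseteq> g k \<longrightarrow> f y \<sqsubset> r)))" for g :: "'b \<Rightarrow> 'a" and j r
  have "\<exists>g. \<forall>j. Q g j (g j)"
  proof (rule dependent_wf_choice)
    show "wf {(j, k). j \<prec> k}"
      by (rule L.wf)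
  next
    fix g g' :: "'b \<Rightarrow> 'a" and j r
    assume "\<And>k. (k, j) \<in> {(j, k). j \<prec> k} \<Longrightarrow> g k = g' k"
    then show "Q g j r = Q g' j r"
      by (auto simp: Q_def)
  next
    fix j and g :: "'b \<Rightarrow> 'a"
    assume IH: "\<And>k. (k, j) \<in> {(j, k). j \<prec> k} \<Longrightarrow> Q g k (g k)"
    show "\<exists>r. Q g j r"
    proof (cases "j \<in> L")
      case True
      have gK: "g k \<in> K" if "k \<prec> j" for k
        using IH[of k] that True L.downward by (auto simp: Q_def)
      have small: "|{k. k \<prec> j}| <o |K|"
        using L.segment_small[OF True] L_less_K ordLess_transitive by blast
      have "\<exists>b\<in>K. g k \<sqsubset> b \<and> (\<forall>y. y \<sqsubseteq> g k \<longrightarrow> f y \<sqsubset> b)" if k: "k \<prec> j" for k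
      proof -
        obtain b where "b \<in> K" "\<forall>y\<in>{y. y \<sqsubseteq> g k}. f y \<sqsubset> b"
          using family_bounded[OF segment_eq_small[OF gK[OF k]], of f] f downward_eq gK[OF k] by blast
        then show ?thesis
          using pair_bounded[OF _ gK[OF k]] less_trans by (metis mem_Collect_eq)
      qed
      then obtain h where h: "\<And>k. k \<prec> j \<Longrightarrow> h k \<in> K \<and> g k \<sqsubset> h k \<and> (\<forall>y. y \<sqsubseteq> g k \<longrightarrow> f y \<sqsubset> h k)"
        by metis
      obtain r where "r \<in> K" "\<forall>k\<in>{k. k \<prec> j}. h k \<sqsubset> r"
        using family_bounded[OF small, of h] h by auto
      then have "Q g j r"
        using h less_trans unfolding Q_def by (metis mem_Collect_eq)
      then show ?thesis ..
    qed (simp add: Q_def)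
  qed
  then show ?thesis
    unfolding Q_def by blast
qed

lemma sequence_supremum:
  assumes g: "\<And>j. j \<in> L \<Longrightarrow> g j \<in> K"
  obtains \<gamma> where "\<gamma> \<in> K" "\<And>j. j \<in> L \<Longrightarrow> g j \<sqsubset> \<gamma>" "\<And>y. y \<sqsubset> \<gamma> \<Longrightarrow> \<exists>j\<in>L. y \<sqsubseteq> g j"
proof -
  obtain b where "b \<in> K \<and> (\<forall>j\<in>L. g j \<sqsubset> b)"
    using family_bounded[OF L_less_K, of g] g by blast
  then obtain \<gamma> where \<gamma>: "\<gamma> \<in> K \<and> (\<forall>j\<in>L. g j \<sqsubset> \<gamma>)"
    "\<And>y. y \<sqsubset> \<gamma> \<Longrightarrow> \<not> (y \<in> K \<and> (\<forall>j\<in>L. g j \<sqsubset> y))"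
    using least_witness[of "\<lambda>b. b \<in> K \<and> (\<forall>j\<in>L. g j \<sqsubset> b)" b] by blast
  then have "\<exists>j\<in>L. y \<sqsubseteq> g j" if "y \<sqsubset> \<gamma>" for y
    using that downward by (meson not_less)
  then show thesis
    using \<gamma>(1) that by blast
qed

lemma stationary_large_cof: "stationary {\<gamma>\<in>K. large_cof \<gamma>}"
  unfolding stationary_def
proof (intro conjI allI impI)
  fix f assume f: "f ` K \<subseteq> K"
  obtain g where g: "\<And>j. j \<in> L \<Longrightarrow> g j \<in> K"
    "\<And>j k. j \<in> L \<Longrightarrow> k \<prec> j \<Longrightarrow> g k \<sqsubset> g j" "\<And>j k y. j \<in> L \<Longrightarrow> k \<prec> j \<Longrightarrow> y \<sqsubseteq> g k \<Longrightarrow> f y \<sqsubset> g j"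
    using increasing_sequence[OF f] by blast
  obtain \<gamma> where \<gamma>: "\<gamma> \<in> K" "\<And>j. j \<in> L \<Longrightarrow> g j \<sqsubset> \<gamma>" "\<And>y. y \<sqsubset> \<gamma> \<Longrightarrow> \<exists>j\<in>L. y \<sqsubseteq> g j"
    using sequence_supremum[of g] g(1) by blast
  have "\<exists>x. x \<sqsubset> \<gamma>"
    using \<gamma>(2) L.infinite_K by (metis ex_in_conv finite.emptyI)
  moreover have "f y \<sqsubset> \<gamma>" if "y \<sqsubset> \<gamma>" for y
    using \<gamma>(3)[OF that] L.no_greatest g(3) \<gamma>(2) by (meson less_trans)
  ultimately have "closed_under f \<gamma>"
    by (simp add: closed_under_def)
  moreover have "large_cof \<gamma>"
    unfolding large_cof_def
  proof (intro allI impI)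
    fix X assume X: "X \<subseteq> {y. y \<sqsubset> \<gamma>}" "|X| <o |L|"
    then obtain j where j: "\<And>x. x \<in> X \<Longrightarrow> j x \<in> L \<and> x \<sqsubseteq> g (j x)"
      using \<gamma>(3) by (metis mem_Collect_eq subsetD)
    then obtain k where "k \<in> L" "\<forall>x\<in>X. j x \<prec> k"
      using L.family_bounded[OF X(2), of j] by blast
    then show "\<exists>b. b \<sqsubset> \<gamma> \<and> (\<forall>x\<in>X. x \<sqsubset> b)"
      using j g(2) \<gamma>(2) by (meson le_less_trans)
  qed
  ultimately show "\<exists>x\<in>{\<gamma> \<in> K. large_cof \<gamma>}. closed_under f x"
    using \<gamma>(1) by blast
qed auto

end

section \<open>Branches of a square sequence and a colouring constant along them\<close>

locale square_sequence = two_regular_cardinals le lt K leL ltL L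
  for le :: "'a \<Rightarrow> 'a \<Rightarrow> bool" (infix \<open>\<sqsubseteq>\<close> 50) and lt :: "'a \<Rightarrow> 'a \<Rightarrow> bool" (infix \<open>\<sqsubset>\<close> 50)
    and K :: "'a set"
    and leL :: "'b \<Rightarrow> 'b \<Rightarrow> bool" (infix \<open>\<preceq>\<close> 50) and ltL :: "'b \<Rightarrow> 'b \<Rightarrow> bool" (infix \<open>\<prec>\<close> 50)
    and L :: "'b set" +
  fixes C :: "'a \<Rightarrow> 'a set"
  assumes C_below: "\<alpha> \<in> K \<Longrightarrow> is_limit \<alpha> \<Longrightarrow> C \<alpha> \<subseteq> {x. x \<sqsubset> \<alpha>}"
    and C_unbounded: "\<alpha> \<in> K \<Longrightarrow> is_limit \<alpha> \<Longrightarrow> limit_point (C \<alpha>) \<alpha>"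
    and C_closed: "\<alpha> \<in> K \<Longrightarrow> is_limit \<alpha> \<Longrightarrow> \<gamma> \<sqsubset> \<alpha> \<Longrightarrow> limit_point (C \<alpha>) \<gamma> \<Longrightarrow> \<gamma> \<in> C \<alpha>"
    and C_coherent: "\<alpha> \<in> K \<Longrightarrow> is_limit \<alpha> \<Longrightarrow> \<gamma> \<in> C \<alpha> \<Longrightarrow> limit_point (C \<alpha>) \<gamma> \<Longrightarrow>
      C \<gamma> = C \<alpha> \<inter> {x. x \<sqsubset> \<gamma>}"
    and no_thread: "D \<subseteq> K \<Longrightarrow> (\<And>b. b \<in> K \<Longrightarrow> \<exists>x\<in>D. b \<sqsubset> x) \<Longrightarrow>
      (\<And>\<gamma>. \<gamma> \<in> K \<Longrightarrow> limit_point D \<gamma> \<Longrightarrow> \<gamma> \<in> D) \<Longrightarrow>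
      \<exists>\<gamma>\<in>D. limit_point D \<gamma> \<and> D \<inter> {x. x \<sqsubset> \<gamma>} \<noteq> C \<gamma>"
begin

definition segments :: "'a \<Rightarrow> 'a set set" where
  "segments \<gamma> = {C \<alpha> \<inter> {x. x \<sqsubset> \<gamma>} | \<alpha>. \<alpha> \<in> K \<and> is_limit \<alpha> \<and> \<gamma> \<sqsubset> \<alpha>}"

text \<open>
  An initial segment of a club \<open>C \<alpha>\<close> that has no last element ends at a limit point \<open>m\<close> of \<open>C \<alpha>\<close>, and
  coherence identifies it as \<open>C m\<close>. This is what keeps the number of initial segments small, although
  \<open>\<gamma>\<close> may have \<open>|K|\<close> or more subsets.
\<close>

lemma segments_cover:
  "segments \<gamma> \<subseteq> insert {} (C ` {\<delta>. \<delta> \<sqsubseteq> \<gamma>} \<union> (\<Union>\<delta>\<in>{\<delta>. \<delta> \<sqsubset> \<gamma>}. insert \<delta> ` segments \<delta>))"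
proof
  fix X assume "X \<in> segments \<gamma>"
  then obtain \<alpha> where \<alpha>: "\<alpha> \<in> K" "is_limit \<alpha>" "\<gamma> \<sqsubset> \<alpha>" and X: "X = C \<alpha> \<inter> {x. x \<sqsubset> \<gamma>}"
    unfolding segments_def by blast
  show "X \<in> insert {} (C ` {\<delta>. \<delta> \<sqsubseteq> \<gamma>} \<union> (\<Union>\<delta>\<in>{\<delta>. \<delta> \<sqsubset> \<gamma>}. insert \<delta> ` segments \<delta>))"
  proof (cases "\<exists>\<delta>\<in>X. \<forall>x\<in>X. x \<sqsubseteq> \<delta>")
    case True
    then obtain \<delta> where \<delta>: "\<delta> \<in> X" "\<forall>x\<in>X. x \<sqsubseteq> \<delta>"
      by blast
    then have \<delta>\<gamma>: "\<delta> \<sqsubset> \<gamma>"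
      using X by blast
    have "X = insert \<delta> (C \<alpha> \<inter> {x. x \<sqsubset> \<delta>})"
      using \<delta> X \<delta>\<gamma> less_trans by (auto simp: le_less)
    moreover have "C \<alpha> \<inter> {x. x \<sqsubset> \<delta>} \<in> segments \<delta>"
      using \<alpha> less_trans[OF \<delta>\<gamma> \<alpha>(3)] unfolding segments_def by blast
    ultimately show ?thesis
      using \<delta>\<gamma> by blast
  next
    case no_max: False
    show ?thesis
    proof (cases "X = {}")
      case False
      \<comment> \<open>The supremum of \<open>X\<close>, which is at most \<open>\<gamma>\<close>.\<close>
      obtain m where m: "\<forall>x\<in>X. x \<sqsubset> m" "\<And>y. y \<sqsubset> m \<Longrightarrow> \<not> (\<forall>x\<in>X. x \<sqsubset> y)"
        using least_witness[of "\<lambda>m. \<forall>x\<in>X. x \<sqsubset> m" \<gamma>] X by blast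
      have m\<gamma>: "m \<sqsubseteq> \<gamma>"
        using m(2)[of \<gamma>] X by (auto simp: not_less[symmetric])
      have "\<exists>z\<in>X. y \<sqsubset> z \<and> z \<sqsubset> m" if "y \<sqsubset> m" for y
      proof -
        obtain x where x: "x \<in> X" "y \<sqsubseteq> x"
          using m(2)[OF \<open>y \<sqsubset> m\<close>] not_less by blast
        then obtain z where "z \<in> X" "x \<sqsubset> z"
          using no_max not_less by blast
        then show ?thesis
          using m(1) x le_less_trans by blast
      qed
      then have "limit_point X m"
        using m(1) False unfolding limit_point_def by blast
      then have lim: "limit_point (C \<alpha>) m"
        using X limit_point_mono by blast
      have "m \<sqsubset> \<alpha>"
        using m\<gamma> \<alpha>(3) by (rule le_less_trans)
      then have "C m = C \<alpha> \<inter> {x. x \<sqsubset> m}"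
        using C_coherent C_closed \<alpha> lim by blast
      also have "\<dots> = X"
        using X m(1) m\<gamma> less_le_trans by blast
      finally show ?thesis
        using m\<gamma> by blast
    qed simp
  qed
qed

lemma segments_small: "\<gamma> \<in> K \<Longrightarrow> |segments \<gamma>| <o |K|"
proof (induction \<gamma> rule: less_induct)
  case (less \<gamma>)
  have "|C ` {\<delta>. \<delta> \<sqsubseteq> \<gamma>}| <o |K|"
    by (intro small_image segment_eq_small less.prems)
  moreover have "|\<Union>\<delta>\<in>{\<delta>. \<delta> \<sqsubset> \<gamma>}. insert \<delta> ` segments \<delta>| <o |K|"
    using less.IH downward[OF less.prems]
    by (intro small_UN segment_small less.prems small_image) auto
  ultimately have "|{{}} \<union> (C ` {\<delta>. \<delta> \<sqsubseteq> \<gamma>} \<union> (\<Union>\<delta>\<in>{\<delta>. \<delta> \<sqsubset> \<gamma>}. insert \<delta> ` segments \<delta>))| <o |K|"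
    using small_finite[of "{{}}"] by (intro small_Un) simp_all
  then show ?case
    by (rule small_subset[rotated]) (use segments_cover in simp)
qed

text \<open>
  If for every \<open>\<gamma>\<close> the value of \<open>C \<alpha> \<inter> \<gamma>\<close> were the same for almost all \<open>\<alpha>\<close> in \<open>S\<close>, then by Fodor's
  lemma stationarily many \<open>\<alpha>\<close> would agree with this value for all \<open>\<gamma> \<sqsubset> \<alpha>\<close> at once. Their clubs
  end-extend each other, and the union would be a thread.
\<close>

lemma branches_split:
  assumes S: "stationary S" and lim: "\<And>\<alpha>. \<alpha> \<in> S \<Longrightarrow> is_limit \<alpha>"
  shows "\<exists>\<gamma>\<in>K. \<forall>e. stationary {\<alpha>\<in>S. C \<alpha> \<inter> {x. x \<sqsubset> \<gamma>} \<noteq> e \<inter> {x. x \<sqsubset> \<gamma>}}"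
proof (rule ccontr)
  assume "\<not> ?thesis"
  then have "\<forall>\<gamma>\<in>K. \<exists>e. \<not> stationary {\<alpha>\<in>S. C \<alpha> \<inter> {x. x \<sqsubset> \<gamma>} \<noteq> e \<inter> {x. x \<sqsubset> \<gamma>}}"
    by blast
  then obtain e where e:
    "\<forall>\<gamma>\<in>K. \<not> stationary {\<alpha>\<in>S. C \<alpha> \<inter> {x. x \<sqsubset> \<gamma>} \<noteq> e \<gamma> \<inter> {x. x \<sqsubset> \<gamma>}}"
    using bchoice[of K "\<lambda>\<gamma> e. \<not> stationary {\<alpha>\<in>S. C \<alpha> \<inter> {x. x \<sqsubset> \<gamma>} \<noteq> e \<inter> {x. x \<sqsubset> \<gamma>}}"] by blast
  define deviates where
    "deviates \<alpha> \<gamma> \<longleftrightarrow> \<gamma> \<sqsubset> \<alpha> \<and> C \<alpha> \<inter> {x. x \<sqsubset> \<gamma>} \<noteq> e \<gamma> \<inter> {x. x \<sqsubset> \<gamma>}" for \<alpha> \<gamma>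
  have SK: "S \<subseteq> K"
    using S by (rule stationary_subset)
  have "\<not> stationary {\<alpha>\<in>S. \<exists>\<gamma>. deviates \<alpha> \<gamma>}"
  proof
    assume *: "stationary {\<alpha>\<in>S. \<exists>\<gamma>. deviates \<alpha> \<gamma>}"
    define f where "f \<alpha> = (SOME \<gamma>. deviates \<alpha> \<gamma>)" for \<alpha>
    have f: "deviates \<alpha> (f \<alpha>)" if "\<exists>\<gamma>. deviates \<alpha> \<gamma>" for \<alpha>
      unfolding f_def using that by (rule someI_ex)
    have "\<exists>c\<in>K. stationary {\<alpha>\<in>{\<alpha>\<in>S. \<exists>\<gamma>. deviates \<alpha> \<gamma>}. f \<alpha> = c}"
      by (rule fodor[OF *]) (use f deviates_def in blast)
    then obtain c where "c \<in> K" and c: "stationary {\<alpha>\<in>{\<alpha>\<in>S. \<exists>\<gamma>. deviates \<alpha> \<gamma>}. f \<alpha> = c}"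
      by blast
    have "stationary {\<alpha>\<in>S. C \<alpha> \<inter> {x. x \<sqsubset> c} \<noteq> e c \<inter> {x. x \<sqsubset> c}}"
      by (rule stationary_mono[OF c]) (use f deviates_def SK in blast)+
    then show False
      using e \<open>c \<in> K\<close> by blast
  qed
  then have S': "stationary {\<alpha>\<in>S. \<not> (\<exists>\<gamma>. deviates \<alpha> \<gamma>)}" (is "stationary ?S'")
    using stationary_split[OF S, of "\<lambda>\<alpha>. \<exists>\<gamma>. deviates \<alpha> \<gamma>"] by blast
  have agree: "x \<in> C \<alpha> \<longleftrightarrow> x \<in> C \<beta>" if \<alpha>: "\<alpha> \<in> ?S'" and \<beta>: "\<beta> \<in> ?S'" and x: "x \<sqsubset> \<alpha>" and le: "\<alpha> \<sqsubseteq> \<beta>" for x \<alpha> \<beta>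
  proof -
    obtain \<gamma> where \<gamma>: "x \<sqsubset> \<gamma>" "\<gamma> \<sqsubset> \<alpha>"
      using lim[of \<alpha>] \<alpha> x unfolding limit_point_def by blast
    then have "\<gamma> \<sqsubset> \<beta>"
      using le less_le_trans by blast
    then show ?thesis
      using \<alpha> \<beta> \<gamma> unfolding deviates_def by blast
  qed
  define D where "D = (\<Union>\<alpha>\<in>?S'. C \<alpha>)"
  have D_below: "D \<inter> {x. x \<sqsubset> \<alpha>} = C \<alpha>" if \<alpha>: "\<alpha> \<in> ?S'" for \<alpha>
  proof
    show "C \<alpha> \<subseteq> D \<inter> {x. x \<sqsubset> \<alpha>}"
      using C_below[of \<alpha>] lim[of \<alpha>] \<alpha> SK unfolding D_def by blast
    show "D \<inter> {x. x \<sqsubset> \<alpha>} \<subseteq> C \<alpha>"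
    proof
      fix x assume x: "x \<in> D \<inter> {x. x \<sqsubset> \<alpha>}"
      then obtain \<beta> where \<beta>: "\<beta> \<in> ?S'" "x \<in> C \<beta>"
        unfolding D_def by blast
      then have "x \<sqsubset> \<beta>"
        using C_below[of \<beta>] lim[of \<beta>] SK by blast
      then show "x \<in> C \<alpha>"
        using agree[OF \<alpha> \<beta>(1)] agree[OF \<beta>(1) \<alpha>] x \<beta>(2) linear[of \<alpha> \<beta>] by blast
    qed
  qed
  have lim_D: "limit_point (C \<alpha>) \<gamma>" if "\<alpha> \<in> ?S'" "\<gamma> \<sqsubset> \<alpha>" "limit_point D \<gamma>" for \<alpha> \<gamma>
    using that(2,3) D_below[OF that(1)] less_trans unfolding limit_point_def by blast
  have "\<exists>\<gamma>\<in>D. limit_point D \<gamma> \<and> D \<inter> {x. x \<sqsubset> \<gamma>} \<noteq> C \<gamma>"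
  proof (rule no_thread)
    show "D \<subseteq> K"
    proof
      fix x assume "x \<in> D"
      then obtain \<alpha> where "\<alpha> \<in> S" "x \<in> C \<alpha>"
        unfolding D_def by blast
      then show "x \<in> K"
        using C_below[of \<alpha>] lim[of \<alpha>] SK downward[of \<alpha> x] by blast
    qed
  next
    fix b assume "b \<in> K"
    then obtain \<alpha> where \<alpha>: "\<alpha> \<in> ?S'" "b \<sqsubset> \<alpha>"
      using stationary_unbounded[OF S'] by blast
    then have "limit_point (C \<alpha>) \<alpha>"
      using C_unbounded lim SK by blast
    then show "\<exists>x\<in>D. b \<sqsubset> x"
      using \<alpha> unfolding limit_point_def D_def by blast
  next
    fix \<gamma> assume \<gamma>: "\<gamma> \<in> K" "limit_point D \<gamma>"
    then obtain \<alpha> where \<alpha>: "\<alpha> \<in> ?S'" "\<gamma> \<sqsubset> \<alpha>"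
      using stationary_unbounded[OF S'] by blast
    then have "\<gamma> \<in> C \<alpha>"
      using C_closed[of \<alpha>] lim[of \<alpha>] SK lim_D[OF \<alpha> \<gamma>(2)] by blast
    then show "\<gamma> \<in> D"
      using \<alpha> unfolding D_def by blast
  qed
  then obtain \<gamma> where \<gamma>: "\<gamma> \<in> D" "limit_point D \<gamma>" "D \<inter> {x. x \<sqsubset> \<gamma>} \<noteq> C \<gamma>"
    by blast
  have "\<gamma> \<in> K"
  proof -
    obtain \<alpha> where "\<alpha> \<in> S" "\<gamma> \<in> C \<alpha>"
      using \<gamma>(1) unfolding D_def by blast
    then show ?thesis
      using C_below[of \<alpha>] lim[of \<alpha>] SK downward[of \<alpha> \<gamma>] by blast
  qed
  then obtain \<alpha> where \<alpha>: "\<alpha> \<in> ?S'" "\<gamma> \<sqsubset> \<alpha>"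
    using stationary_unbounded[OF S'] by blast
  then have "C \<gamma> = C \<alpha> \<inter> {x. x \<sqsubset> \<gamma>}"
    using C_coherent[of \<alpha> \<gamma>] C_closed[of \<alpha> \<gamma>] lim[of \<alpha>] SK lim_D[OF \<alpha> \<gamma>(2)] by blast
  also have "\<dots> = D \<inter> {x. x \<sqsubset> \<gamma>}"
    using D_below[OF \<alpha>(1)] \<alpha>(2) less_trans by blast
  finally show False
    using \<gamma>(3) by simp
qed

abbreviation limits :: "'a set" where
  "limits \<equiv> {\<alpha>\<in>K. is_limit \<alpha>}"

definition fibre :: "'a \<Rightarrow> 'a set \<Rightarrow> 'a set" where
  "fibre \<gamma> e = {\<alpha>\<in>limits. \<gamma> \<sqsubset> \<alpha> \<and> C \<alpha> \<inter> {x. x \<sqsubset> \<gamma>} = e}"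

lemma stationary_limits_above:
  assumes "\<gamma> \<in> K"
  shows "stationary {\<alpha>\<in>limits. \<gamma> \<sqsubset> \<alpha>}"
proof -
  have "stationary {\<alpha>\<in>{\<gamma>\<in>K. large_cof \<gamma>}. limit_point K \<alpha>}"
    using no_greatest by (intro stationary_limits stationary_large_cof) auto
  then have "stationary limits"
    by (rule stationary_mono) (auto intro: limit_point_mono)
  then show ?thesis
    using assms by (rule stationary_above)
qed

text \<open>
  There are few initial segments at level \<open>\<gamma>\<close>, so one level \<open>\<delta>\<close> splits all stationary fibres over
  \<open>\<gamma>\<close>; splitting persists when the level is raised.
\<close>

lemma uniform_splitting:
  assumes "\<gamma> \<in> K"
  shows "\<exists>\<delta>\<in>K. \<forall>e. stationary (fibre \<gamma> e) \<longrightarrow>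
    (\<forall>d. stationary {\<alpha>\<in>fibre \<gamma> e. C \<alpha> \<inter> {x. x \<sqsubset> \<delta>} \<noteq> d \<inter> {x. x \<sqsubset> \<delta>}})"
proof -
  define E where "E = {e. stationary (fibre \<gamma> e)}"
  have "E \<subseteq> segments \<gamma>"
  proof
    fix e assume "e \<in> E"
    then obtain \<alpha> where "\<alpha> \<in> fibre \<gamma> e"
      using stationary_unbounded[OF _ assms] unfolding E_def by blast
    then show "e \<in> segments \<gamma>"
      unfolding fibre_def segments_def by blast
  qed
  then have small: "|E| <o |K|"
    using segments_small[OF assms] small_subset by blast
  define split where "split e \<delta> \<longleftrightarrow>
    (\<forall>d. stationary {\<alpha>\<in>fibre \<gamma> e. C \<alpha> \<inter> {x. x \<sqsubset> \<delta>} \<noteq> d \<inter> {x. x \<sqsubset> \<delta>}})" for e \<delta>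
  have "\<exists>\<delta>\<in>K. split e \<delta>" if "e \<in> E" for e
    unfolding split_def using that by (intro branches_split) (auto simp: E_def fibre_def)
  then obtain s where s: "\<And>e. e \<in> E \<Longrightarrow> s e \<in> K \<and> split e (s e)"
    by metis
  then obtain \<delta> where \<delta>: "\<delta> \<in> K" "\<forall>e\<in>E. s e \<sqsubset> \<delta>"
    using family_bounded[OF small, of s] by blast
  have "stationary {\<alpha>\<in>fibre \<gamma> e. C \<alpha> \<inter> {x. x \<sqsubset> \<delta>} \<noteq> d \<inter> {x. x \<sqsubset> \<delta>}}" if e: "e \<in> E" for e d
  proof -
    have "stationary {\<alpha>\<in>fibre \<gamma> e. C \<alpha> \<inter> {x. x \<sqsubset> s e} \<noteq> d \<inter> {x. x \<sqsubset> s e}}"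
      using s[OF e] unfolding split_def by blast
    moreover have "x \<sqsubset> \<delta>" if "x \<sqsubset> s e" for x
      using that \<delta>(2) e less_trans by blast
    ultimately show ?thesis
      by (rule_tac stationary_mono) (auto simp: fibre_def)
  qed
  then show ?thesis
    using \<delta>(1) unfolding E_def by blast
qed

text \<open>
  The levels \<open>g j\<close> are chosen so that every stationary fibre over \<open>g i\<close> is split below \<open>g j\<close> for \<open>i \<prec> j\<close>. Let
  \<open>\<sigma>\<close> be their supremum and \<open>d\<close> the value of \<open>C \<alpha> \<inter> \<sigma>\<close> on a stationary set of \<open>\<alpha>\<close>. The colour
  \<open>h \<alpha>\<close> is the first stage \<open>j\<close> at which \<open>C \<alpha>\<close> differs from \<open>d\<close> below \<open>g j\<close>. Since it is
  determined by \<open>C \<alpha> \<inter> \<sigma>\<close>, it is constant along the part of a branch above \<open>\<sigma>\<close>; for this reason the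
  ladder \<open>D\<close> deletes from \<open>C \<alpha>\<close> everything up to \<open>\<sigma>\<close>. A successor gets its predecessor as only rung, so
  that the conclusions hold for all \<open>\<alpha>\<close> in \<open>K\<close>.
\<close>

lemma coloured_ladder_exists:
  obtains D :: "'a \<Rightarrow> 'a set" and h :: "'a \<Rightarrow> 'b"
  where "\<And>\<alpha>. \<alpha> \<in> K \<Longrightarrow> h \<alpha> \<in> L"
    "\<And>i. i \<in> L \<Longrightarrow> stationary {\<alpha>\<in>K. i \<prec> h \<alpha>}"
    "\<And>\<alpha>. \<alpha> \<in> K \<Longrightarrow> D \<alpha> \<subseteq> {x. x \<sqsubset> \<alpha>}"
    "\<And>\<alpha> x. \<alpha> \<in> K \<Longrightarrow> x \<sqsubset> \<alpha> \<Longrightarrow> \<exists>y\<in>D \<alpha>. x \<sqsubseteq> y"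
    "\<And>\<alpha> \<gamma>. \<alpha> \<in> K \<Longrightarrow> \<gamma> \<sqsubset> \<alpha> \<Longrightarrow> limit_point (D \<alpha>) \<gamma> \<Longrightarrow> \<gamma> \<in> D \<alpha>"
    "\<And>\<alpha> \<gamma>. \<alpha> \<in> K \<Longrightarrow> \<gamma> \<in> D \<alpha> \<Longrightarrow> limit_point (D \<alpha>) \<gamma> \<Longrightarrow> D \<gamma> = D \<alpha> \<inter> {x. x \<sqsubset> \<gamma>}"
    "\<And>\<alpha> \<gamma>. \<alpha> \<in> K \<Longrightarrow> \<gamma> \<in> D \<alpha> \<Longrightarrow> limit_point (D \<alpha>) \<gamma> \<Longrightarrow> h \<gamma> = h \<alpha>"
proof -
  have "\<exists>G. \<forall>\<gamma>\<in>K. G \<gamma> \<in> K \<and> (\<forall>e. stationary (fibre \<gamma> e) \<longrightarrow>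
      (\<forall>d. stationary {\<alpha>\<in>fibre \<gamma> e. C \<alpha> \<inter> {x. x \<sqsubset> G \<gamma>} \<noteq> d \<inter> {x. x \<sqsubset> G \<gamma>}}))"
    by (rule bchoice) (use uniform_splitting in blast)
  then obtain G where G: "\<And>\<gamma>. \<gamma> \<in> K \<Longrightarrow> G \<gamma> \<in> K"
    "\<And>\<gamma> e d. \<gamma> \<in> K \<Longrightarrow> stationary (fibre \<gamma> e) \<Longrightarrow>
      stationary {\<alpha>\<in>fibre \<gamma> e. C \<alpha> \<inter> {x. x \<sqsubset> G \<gamma>} \<noteq> d \<inter> {x. x \<sqsubset> G \<gamma>}}"
    by blast
  obtain g where gK: "\<And>j. j \<in> L \<Longrightarrow> g j \<in> K"
    and g_mono: "\<And>j k. j \<in> L \<Longrightarrow> k \<prec> j \<Longrightarrow> g k \<sqsubset> g j"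
    and g_closed: "\<And>j k y. j \<in> L \<Longrightarrow> k \<prec> j \<Longrightarrow> y \<sqsubseteq> g k \<Longrightarrow> G y \<sqsubset> g j"
    using increasing_sequence[of G] G(1) by (metis image_subsetI)
  obtain \<sigma> where \<sigma>: "\<sigma> \<in> K" "\<And>j. j \<in> L \<Longrightarrow> g j \<sqsubset> \<sigma>"
    using sequence_supremum[of g] gK by metis
  have "\<exists>d\<in>segments \<sigma>. stationary {\<alpha>\<in>{\<alpha>\<in>limits. \<sigma> \<sqsubset> \<alpha>}. C \<alpha> \<inter> {x. x \<sqsubset> \<sigma>} = d}"
    using \<sigma>(1) by (intro stationary_partition stationary_limits_above segments_small)
      (auto simp: segments_def)
  then obtain d where "stationary {\<alpha>\<in>{\<alpha>\<in>limits. \<sigma> \<sqsubset> \<alpha>}. C \<alpha> \<inter> {x. x \<sqsubset> \<sigma>} = d}"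
    by blast
  then have d: "stationary (fibre \<sigma> d)"
    unfolding fibre_def by (rule stationary_mono) auto
  define deviates where
    "deviates \<alpha> j \<longleftrightarrow> j \<in> L \<and> C \<alpha> \<inter> {x. x \<sqsubset> g j} \<noteq> d \<inter> {x. x \<sqsubset> g j}" for \<alpha> j
  define first where "first \<alpha> j \<longleftrightarrow> deviates \<alpha> j \<and> (\<forall>k. k \<prec> j \<longrightarrow> \<not> deviates \<alpha> k)" for \<alpha> j
  obtain i0 where i0: "i0 \<in> L"
    using L.infinite_K by (metis ex_in_conv finite.emptyI)
  \<comment> \<open>The default colour \<open>i0\<close> makes \<open>h\<close> constant, hence coherent, up to \<open>\<sigma>\<close>.\<close>
  define h where "h \<alpha> = (if \<alpha> \<in> limits \<and> \<sigma> \<sqsubset> \<alpha> \<and> (\<exists>j. first \<alpha> j) then SOME j. first \<alpha> j else i0)" for \<alpha>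
  define D where "D \<alpha> = (if \<alpha> \<in> limits then (if \<sigma> \<sqsubset> \<alpha> then {x\<in>C \<alpha>. \<sigma> \<sqsubset> x} else C \<alpha>)
    else {x. x \<sqsubset> \<alpha> \<and> (\<forall>y. \<not> (x \<sqsubset> y \<and> y \<sqsubset> \<alpha>))})" for \<alpha>
  have h_first: "first \<alpha> (h \<alpha>)" if "\<alpha> \<in> limits" "\<sigma> \<sqsubset> \<alpha>" "deviates \<alpha> j" for \<alpha> j
  proof -
    have "\<exists>j. first \<alpha> j"
      using L.least_witness[of "deviates \<alpha>" j] that(3) unfolding first_def by blast
    then show ?thesis
      using that someI_ex[of "first \<alpha>"] unfolding h_def by simp
  qed
  have D_lim: "\<alpha> \<in> limits \<and> limit_point (C \<alpha>) \<gamma> \<and> (\<sigma> \<sqsubset> \<alpha> \<longrightarrow> \<sigma> \<sqsubset> \<gamma>)"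
    if below: "\<gamma> \<sqsubset> \<alpha>" and lim: "limit_point (D \<alpha>) \<gamma>" for \<alpha> \<gamma>
  proof -
    have "\<alpha> \<in> limits"
    proof (rule ccontr)
      assume "\<alpha> \<notin> limits"
      then have D: "D \<alpha> = {x. x \<sqsubset> \<alpha> \<and> (\<forall>y. \<not> (x \<sqsubset> y \<and> y \<sqsubset> \<alpha>))}"
        unfolding D_def by (rule if_not_P)
      obtain y where "y \<in> D \<alpha>" "y \<sqsubset> \<gamma>"
        using lim unfolding limit_point_def by blast
      then show False
        using below unfolding D by blast
    qed
    moreover have "limit_point (C \<alpha>) \<gamma>"
      using lim calculation unfolding D_def by (auto split: if_splits elim: limit_point_mono)
    moreover have "\<sigma> \<sqsubset> \<gamma>" if "\<sigma> \<sqsubset> \<alpha>"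
    proof -
      obtain y where "y \<in> D \<alpha>" "y \<sqsubset> \<gamma>"
        using lim unfolding limit_point_def by blast
      moreover have "D \<alpha> = {x\<in>C \<alpha>. \<sigma> \<sqsubset> x}"
        using \<open>\<alpha> \<in> limits\<close> that unfolding D_def by simp
      ultimately show ?thesis
        using less_trans by blast
    qed
    ultimately show ?thesis
      by blast
  qed
  have D_closed: "\<gamma> \<in> D \<alpha>" if "\<alpha> \<in> K" "\<gamma> \<sqsubset> \<alpha>" "limit_point (D \<alpha>) \<gamma>" for \<alpha> \<gamma>
    using D_lim[OF that(2,3)] C_closed[OF that(1) _ that(2)] unfolding D_def by auto
  have D_below: "D \<alpha> \<subseteq> {x. x \<sqsubset> \<alpha>}" if "\<alpha> \<in> K" for \<alpha>
    using C_below[OF that] unfolding D_def by auto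
  have C_restr: "C \<gamma> = C \<alpha> \<inter> {x. x \<sqsubset> \<gamma>} \<and> \<gamma> \<in> limits"
    if "\<alpha> \<in> K" "\<gamma> \<in> D \<alpha>" "limit_point (D \<alpha>) \<gamma>" for \<alpha> \<gamma>
  proof -
    have \<gamma>: "\<gamma> \<sqsubset> \<alpha>"
      using that D_below by blast
    then have "\<alpha> \<in> limits" "limit_point (C \<alpha>) \<gamma>"
      using D_lim that(3) by blast+
    then show ?thesis
      using C_coherent[OF that(1)] C_closed[OF that(1)] \<gamma> downward[OF that(1) \<gamma>]
        limit_point_mono[of "C \<alpha>" \<gamma> UNIV] by blast
  qed
  show thesis
  proof (rule that[of h D])
    show "h \<alpha> \<in> L" for \<alpha>
    proof (cases "\<alpha> \<in> limits \<and> \<sigma> \<sqsubset> \<alpha> \<and> (\<exists>j. first \<alpha> j)")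
      case True
      then have "first \<alpha> (h \<alpha>)"
        using someI_ex[of "first \<alpha>"] unfolding h_def by simp
      then show ?thesis
        unfolding first_def deviates_def by blast
    next
      case False
      then show ?thesis
        unfolding h_def by (simp only: if_False i0)
    qed
  next
    fix i assume i: "i \<in> L"
    then obtain j where j: "j \<in> L" "i \<prec> j"
      using L.no_greatest by blast
    have sub: "x \<sqsubset> \<sigma>" if "x \<sqsubset> g j" for x
      using that \<sigma>(2)[OF j(1)] less_trans by blast
    \<comment> \<open>Branches that follow \<open>d\<close> up to \<open>g i\<close> but leave it below \<open>g j\<close> have a colour above \<open>i\<close>.\<close>
    have "stationary (fibre (g i) (d \<inter> {x. x \<sqsubset> g i}))"
    proof (rule stationary_mono[OF d])
      show "fibre \<sigma> d \<subseteq> fibre (g i) (d \<inter> {x. x \<sqsubset> g i})"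
      proof
        fix \<alpha> assume \<alpha>: "\<alpha> \<in> fibre \<sigma> d"
        then have "\<alpha> \<in> limits" "C \<alpha> \<inter> {x. x \<sqsubset> \<sigma>} = d" "g i \<sqsubset> \<alpha>"
          using \<sigma>(2)[OF i] less_trans unfolding fibre_def by blast+
        moreover have "x \<sqsubset> \<sigma>" if "x \<sqsubset> g i" for x
          using less_trans[OF that \<sigma>(2)[OF i]] .
        ultimately show "\<alpha> \<in> fibre (g i) (d \<inter> {x. x \<sqsubset> g i})"
          unfolding fibre_def by blast
      qed
    qed (auto simp: fibre_def)
    then have "stationary {\<alpha>\<in>fibre (g i) (d \<inter> {x. x \<sqsubset> g i}).
        C \<alpha> \<inter> {x. x \<sqsubset> G (g i)} \<noteq> d \<inter> {x. x \<sqsubset> G (g i)}}" (is "stationary ?R")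
      by (rule G(2)[OF gK[OF i]])
    then have "stationary {\<alpha>\<in>?R. \<sigma> \<sqsubset> \<alpha>}"
      using \<sigma>(1) by (rule stationary_above)
    then show "stationary {\<alpha>\<in>K. i \<prec> h \<alpha>}"
    proof (rule stationary_mono)
      show "{\<alpha>\<in>?R. \<sigma> \<sqsubset> \<alpha>} \<subseteq> {\<alpha>\<in>K. i \<prec> h \<alpha>}"
      proof
        fix \<alpha> assume \<alpha>: "\<alpha> \<in> {\<alpha>\<in>?R. \<sigma> \<sqsubset> \<alpha>}"
        have "G (g i) \<sqsubset> g j"
          using g_closed[OF j] by blast
        then have "x \<sqsubset> g j" if "x \<sqsubset> G (g i)" for x
          using that less_trans by blast
        then have "deviates \<alpha> j"
          using \<alpha> j(1) unfolding deviates_def by blast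
        then have first: "first \<alpha> (h \<alpha>)"
          using h_first[of \<alpha> j] \<alpha> unfolding fibre_def by blast
        have "\<not> h \<alpha> \<preceq> i"
        proof
          assume "h \<alpha> \<preceq> i"
          then have "g (h \<alpha>) \<sqsubseteq> g i"
            using g_mono[OF i] L.le_less less_imp_le by blast
          then have "x \<sqsubset> g i" if "x \<sqsubset> g (h \<alpha>)" for x
            using that less_le_trans by blast
          then have "\<not> deviates \<alpha> (h \<alpha>)"
            using \<alpha> unfolding deviates_def fibre_def by blast
          then show False
            using first unfolding first_def by blast
        qed
        then show "\<alpha> \<in> {\<alpha>\<in>K. i \<prec> h \<alpha>}"
          using \<alpha> L.not_le unfolding fibre_def by blast
      qed
    qed blast
  next
    show "D \<alpha> \<subseteq> {x. x \<sqsubset> \<alpha>}" if "\<alpha> \<in> K" for \<alpha>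
      using that by (rule D_below)
  next
    fix \<alpha> x assume \<alpha>: "\<alpha> \<in> K" "x \<sqsubset> \<alpha>"
    show "\<exists>y\<in>D \<alpha>. x \<sqsubseteq> y"
    proof (cases "\<alpha> \<in> limits")
      case True
      then have lim: "limit_point (C \<alpha>) \<alpha>"
        using C_unbounded by blast
      then obtain y where y: "y \<in> C \<alpha>" "x \<sqsubset> y" "y \<sqsubset> \<alpha>"
        using \<alpha>(2) unfolding limit_point_def by blast
      show ?thesis
      proof (cases "\<sigma> \<sqsubset> \<alpha>")
        case \<sigma>\<alpha>: True
        define z where "z = (if \<sigma> \<sqsubset> y then y else \<sigma>)"
        have "z \<sqsubset> \<alpha>" "\<sigma> \<sqsubseteq> z" "y \<sqsubseteq> z"
          using \<sigma>\<alpha> y(3) not_less by (auto simp: z_def less_imp_le)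
        then obtain w where w: "w \<in> C \<alpha>" "z \<sqsubset> w"
          using lim unfolding limit_point_def by blast
        have "\<sigma> \<sqsubset> w" "x \<sqsubseteq> w"
          using le_less_trans[OF \<open>\<sigma> \<sqsubseteq> z\<close> w(2)] le_less_trans[OF \<open>y \<sqsubseteq> z\<close> w(2)] y(2)
            less_trans less_imp_le by blast+
        then have "w \<in> D \<alpha>" "x \<sqsubseteq> w"
          using True \<sigma>\<alpha> w(1) unfolding D_def by simp_all
        then show ?thesis
          by blast
      qed (use True y less_imp_le in \<open>auto simp: D_def\<close>)
    next
      case False
      then obtain y where "y \<sqsubset> \<alpha>" "\<forall>z. \<not> (y \<sqsubset> z \<and> z \<sqsubset> \<alpha>)"
        using \<alpha> unfolding limit_point_def by blast
      moreover have "x \<sqsubseteq> y"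
        using calculation(2) \<alpha>(2) not_less by blast
      ultimately show ?thesis
        using False unfolding D_def by auto
    qed
  next
    show "\<gamma> \<in> D \<alpha>" if "\<alpha> \<in> K" "\<gamma> \<sqsubset> \<alpha>" "limit_point (D \<alpha>) \<gamma>" for \<alpha> \<gamma>
      using that by (rule D_closed)
  next
    fix \<alpha> \<gamma> assume \<alpha>: "\<alpha> \<in> K" and \<gamma>: "\<gamma> \<in> D \<alpha>" "limit_point (D \<alpha>) \<gamma>"
    note restr = C_restr[OF \<alpha> \<gamma>]
    have \<gamma>\<alpha>: "\<gamma> \<sqsubset> \<alpha>"
      using D_below[OF \<alpha>] \<gamma>(1) by blast
    have lim: "\<alpha> \<in> limits" "\<sigma> \<sqsubset> \<alpha> \<longleftrightarrow> \<sigma> \<sqsubset> \<gamma>"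
      using D_lim[OF \<gamma>\<alpha> \<gamma>(2)] \<gamma>\<alpha> less_trans by blast+
    then show "D \<gamma> = D \<alpha> \<inter> {x. x \<sqsubset> \<gamma>}"
      using restr unfolding D_def by auto
    show "h \<gamma> = h \<alpha>"
    proof (cases "\<sigma> \<sqsubset> \<alpha>")
      case True
      have "deviates \<gamma> j \<longleftrightarrow> deviates \<alpha> j" for j
      proof (cases "j \<in> L")
        case j: True
        have "x \<sqsubset> \<gamma>" if "x \<sqsubset> g j" for x
          using that \<sigma>(2)[OF j] True lim(2) less_trans by blast
        then show ?thesis
          using restr unfolding deviates_def by blast
      qed (simp add: deviates_def)
      then have "first \<gamma> = first \<alpha>"
        unfolding first_def by blast
      then show ?thesis
        using lim restr unfolding h_def by auto
    qed (use lim in \<open>simp add: h_def\<close>)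
  qed
qed

end

section \<open>An increasing family of trees\<close>

locale coloured_ladder = two_regular_cardinals le lt K leL ltL L
  for le :: "'a \<Rightarrow> 'a \<Rightarrow> bool" (infix \<open>\<sqsubseteq>\<close> 50) and lt :: "'a \<Rightarrow> 'a \<Rightarrow> bool" (infix \<open>\<sqsubset>\<close> 50)
    and K :: "'a set"
    and leL :: "'b \<Rightarrow> 'b \<Rightarrow> bool" (infix \<open>\<preceq>\<close> 50) and ltL :: "'b \<Rightarrow> 'b \<Rightarrow> bool" (infix \<open>\<prec>\<close> 50)
    and L :: "'b set" +
  fixes D :: "'a \<Rightarrow> 'a set" and h :: "'a \<Rightarrow> 'b"
  assumes h_in_L: "\<alpha> \<in> K \<Longrightarrow> h \<alpha> \<in> L"
    and h_stationary: "i \<in> L \<Longrightarrow> stationary {\<alpha>\<in>K. i \<prec> h \<alpha>}"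
    and D_below: "\<alpha> \<in> K \<Longrightarrow> D \<alpha> \<subseteq> {x. x \<sqsubset> \<alpha>}"
    and D_cofinal: "\<alpha> \<in> K \<Longrightarrow> x \<sqsubset> \<alpha> \<Longrightarrow> \<exists>y\<in>D \<alpha>. x \<sqsubseteq> y"
    and D_closed: "\<alpha> \<in> K \<Longrightarrow> \<gamma> \<sqsubset> \<alpha> \<Longrightarrow> limit_point (D \<alpha>) \<gamma> \<Longrightarrow> \<gamma> \<in> D \<alpha>"
    and D_coherent: "\<alpha> \<in> K \<Longrightarrow> \<gamma> \<in> D \<alpha> \<Longrightarrow> limit_point (D \<alpha>) \<gamma> \<Longrightarrow> D \<gamma> = D \<alpha> \<inter> {x. x \<sqsubset> \<gamma>}"
    and h_coherent: "\<alpha> \<in> K \<Longrightarrow> \<gamma> \<in> D \<alpha> \<Longrightarrow> limit_point (D \<alpha>) \<gamma> \<Longrightarrow> h \<gamma> = h \<alpha>"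
begin

text \<open>
  The relation \<open>below i\<close> is the \<open>i\<close>-th tree order, and \<open>good i \<beta> \<alpha>\<close> singles out the rungs \<open>\<beta>\<close> of \<open>D \<alpha>\<close>
  whose tree predecessors \<open>\<alpha>\<close> inherits, together with \<open>\<beta>\<close>. Limit points of \<open>D \<alpha>\<close> are good as soon as
  \<open>h \<alpha> \<preceq> i\<close>; after a limit point, or from the least rung on, the good rungs continue as long as consecutive
  rungs are related by \<open>below i\<close>. Restarting at limit points makes the good rungs of
  \<open>\<alpha>\<close> below a limit point \<open>\<delta>\<close> of \<open>D \<alpha>\<close> good for \<open>\<delta>\<close>.
\<close>

inductive good below :: "'b \<Rightarrow> 'a \<Rightarrow> 'a \<Rightarrow> bool" for i where
  limit: "\<alpha> \<in> K \<Longrightarrow> h \<alpha> \<preceq> i \<Longrightarrow> \<beta> \<in> D \<alpha> \<Longrightarrow> limit_point (D \<alpha>) \<beta> \<Longrightarrow> good i \<beta> \<alpha>"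
| least: "\<alpha> \<in> K \<Longrightarrow> h \<alpha> \<preceq> i \<Longrightarrow> h \<beta> \<preceq> i \<Longrightarrow> \<beta> \<in> D \<alpha> \<Longrightarrow> (\<And>x. x \<in> D \<alpha> \<Longrightarrow> \<beta> \<sqsubseteq> x) \<Longrightarrow> good i \<beta> \<alpha>"
| step: "good i \<beta> \<alpha> \<Longrightarrow> \<beta>' \<in> D \<alpha> \<Longrightarrow> \<beta> \<sqsubset> \<beta>' \<Longrightarrow> (\<And>x. x \<in> D \<alpha> \<Longrightarrow> x \<sqsubset> \<beta>' \<Longrightarrow> x \<sqsubseteq> \<beta>) \<Longrightarrow>
    below i \<beta> \<beta>' \<Longrightarrow> good i \<beta>' \<alpha>"
| base: "good i \<beta> \<alpha> \<Longrightarrow> below i \<beta> \<alpha>"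
| extend: "below i \<gamma> \<beta> \<Longrightarrow> good i \<beta> \<alpha> \<Longrightarrow> below i \<gamma> \<alpha>"

lemma good_below_props:
  shows good_props: "good i \<beta> \<alpha> \<Longrightarrow> \<alpha> \<in> K \<and> \<beta> \<in> D \<alpha> \<and> \<beta> \<sqsubset> \<alpha> \<and> h \<alpha> \<preceq> i \<and> h \<beta> \<preceq> i"
    and below_props: "below i \<beta> \<alpha> \<Longrightarrow> \<alpha> \<in> K \<and> \<beta> \<sqsubset> \<alpha> \<and> h \<alpha> \<preceq> i \<and> h \<beta> \<preceq> i"
proof (induction rule: good_below.inducts)
  case (limit \<alpha> \<beta>)
  then show ?case
    using D_below h_coherent by auto
next
  case (least \<alpha> \<beta>)
  then show ?case
    using D_below by auto
next
  case (step \<beta> \<alpha> \<beta>')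
  then show ?case
    using D_below by auto
next
  case (extend \<gamma> \<beta> \<alpha>)
  then show ?case
    using less_trans[of \<gamma> \<beta> \<alpha>] by blast
qed blast

lemma
  assumes "i \<preceq> j"
  shows good_increasing: "good i \<beta> \<alpha> \<Longrightarrow> good j \<beta> \<alpha>"
    and below_increasing: "below i \<beta> \<alpha> \<Longrightarrow> below j \<beta> \<alpha>"
proof (induction rule: good_below.inducts)
  case (limit \<alpha> \<beta>)
  then show ?case
    using assms L.order_trans by (intro good_below.limit)
next
  case (least \<alpha> \<beta>)
  then show ?case
    using assms L.order_trans by (intro good_below.least)
next
  case (step \<beta> \<alpha> \<beta>')
  show ?case
    by (rule good_below.step[of j \<beta>]) (use step in auto)
next
  case (base \<beta> \<alpha>)
  then show ?case
    by (intro good_below.base)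
next
  case (extend \<gamma> \<beta> \<alpha>)
  show ?case
    by (rule good_below.extend) (use extend in auto)
qed

lemma below_iff: "below i \<gamma> \<alpha> \<longleftrightarrow> (\<exists>\<beta>. good i \<beta> \<alpha> \<and> (\<gamma> = \<beta> \<or> below i \<gamma> \<beta>))"
  by (subst below.simps) blast

lemma below_trans:
  assumes "below i \<gamma> \<beta>" "below i \<beta> \<alpha>"
  shows "below i \<gamma> \<alpha>"
  using assms(2)
proof (induction \<alpha> rule: less_induct)
  case (less \<alpha>)
  then obtain \<eta> where \<eta>: "good i \<eta> \<alpha>" "\<beta> = \<eta> \<or> below i \<beta> \<eta>"
    using below_iff by blast
  then have "below i \<gamma> \<eta>"
    using less.IH[of \<eta>] assms(1) good_props by blast
  then show ?case
    using \<eta>(1) by (rule extend)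
qed

lemma good_restrict:
  assumes "good i \<beta> \<alpha>" "\<delta> \<in> D \<alpha>" "limit_point (D \<alpha>) \<delta>" "\<beta> \<sqsubset> \<delta>"
  shows "good i \<beta> \<delta>"
proof -
  have \<alpha>: "\<alpha> \<in> K" "h \<alpha> \<preceq> i"
    using good_props[OF assms(1)] by blast+
  have \<delta>: "\<delta> \<in> K" "h \<delta> \<preceq> i" and D: "D \<delta> = D \<alpha> \<inter> {x. x \<sqsubset> \<delta>}"
    using D_coherent[OF \<alpha>(1) assms(2,3)] h_coherent[OF \<alpha>(1) assms(2,3)] \<alpha> assms(2)
      D_below[OF \<alpha>(1)] downward[OF \<alpha>(1), of \<delta>] by auto
  have "good i \<beta> \<alpha> \<Longrightarrow> \<beta> \<sqsubset> \<delta> \<Longrightarrow> good i \<beta> \<delta>" for \<beta>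
  proof (induction \<beta> rule: less_induct)
    case (less \<beta>)
    from less.prems(1) show ?case
    proof cases
      case limit
      then have "limit_point (D \<delta>) \<beta>"
        using less.prems(2) less_trans unfolding limit_point_def D by blast
      then show ?thesis
        using limit less.prems(2) \<delta> D by (intro good_below.limit) auto
    next
      case least
      then show ?thesis
        using less.prems(2) \<delta> D by (intro good_below.least) auto
    next
      case (step \<beta>0)
      then have "good i \<beta>0 \<delta>"
        using less.IH[of \<beta>0] less.prems(2) less_trans by blast
      then show ?thesis
        by (rule good_below.step[of i \<beta>0]) (use step less.prems(2) D in auto)
    qed
  qed
  then show ?thesis
    using assms by blast
qed

text \<open>
  The predecessors of a point form a chain. For two good rungs \<open>\<eta> \<sqsubset> \<eta>'\<close> of \<open>\<alpha>\<close> this is an induction along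
  \<open>D \<alpha>\<close>, with coherence (lemma \<open>good_restrict\<close>) when \<open>\<eta>'\<close> is a limit point; other predecessors lie
  below good rungs, and induction on \<open>\<alpha>\<close> applies.
\<close>

lemma below_comparable:
  assumes "below i \<beta> \<alpha>" "below i \<beta>' \<alpha>" "\<beta> \<sqsubset> \<beta>'"
  shows "below i \<beta> \<beta>'"
  using assms
proof (induction \<alpha> arbitrary: \<beta> \<beta>' rule: less_induct)
  case (less \<alpha>)
  have good_good: "good i \<eta> \<alpha> \<Longrightarrow> good i \<eta>' \<alpha> \<Longrightarrow> \<eta> \<sqsubset> \<eta>' \<Longrightarrow> below i \<eta> \<eta>'" for \<eta> \<eta>'
  proof (induction \<eta>' rule: less_induct)
    case (less \<eta>')
    from less.prems(2) show ?case
    proof cases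
      case limit
      then show ?thesis
        using good_restrict[OF less.prems(1)] less.prems(3) by (blast intro: base)
    next
      case least
      then show ?thesis
        using good_props[OF less.prems(1)] less.prems(3) not_less by blast
    next
      case (step \<eta>0)
      have "\<eta> \<sqsubseteq> \<eta>0"
        using step(4) good_props[OF less.prems(1)] less.prems(3) by blast
      then have "\<eta> = \<eta>0 \<or> \<eta> \<sqsubset> \<eta>0"
        by (auto simp: le_less)
      then have "\<eta> = \<eta>0 \<or> below i \<eta> \<eta>0"
        using less.IH[of \<eta>0] step(1,3) less.prems(1) by blast
      then show ?thesis
        using step below_trans by blast
    qed
  qed
  obtain \<eta> \<eta>' where \<eta>: "good i \<eta> \<alpha>" "\<beta> = \<eta> \<or> below i \<beta> \<eta>"
    and \<eta>': "good i \<eta>' \<alpha>" "\<beta>' = \<eta>' \<or> below i \<beta>' \<eta>'"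
    using less.prems(1,2) below_iff by blast
  have lt: "\<eta> \<sqsubset> \<alpha>" "\<eta>' \<sqsubset> \<alpha>" and le: "\<beta> \<sqsubseteq> \<eta>" "\<beta>' \<sqsubseteq> \<eta>'"
    using good_props \<eta> \<eta>' below_props less_imp_le by blast+
  consider "\<eta> = \<eta>'" | "\<eta> \<sqsubset> \<eta>'" | "\<eta>' \<sqsubset> \<eta>"
    using less_linear by blast
  then show ?case
  proof cases
    case 1
    then have "\<beta> \<noteq> \<eta>"
      using le(2) less.prems(3) not_le by blast
    then show ?thesis
      using 1 \<eta> \<eta>' less.IH[OF lt(1)] less.prems(3) by blast
  next
    case 2
    then have "below i \<beta> \<eta>'"
      using good_good[OF \<eta>(1) \<eta>'(1)] \<eta>(2) below_trans by blast
    then show ?thesis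
      using \<eta>'(2) less.IH[OF lt(2)] less.prems(3) by blast
  next
    case 3
    then have "below i \<beta>' \<eta>"
      using good_good[OF \<eta>'(1) \<eta>(1)] \<eta>'(2) below_trans by blast
    moreover have "\<beta> \<noteq> \<eta>"
      using less_trans[OF le_less_trans[OF le(2) 3]] less.prems(3) less_irrefl by blast
    ultimately show ?thesis
      using \<eta>(2) less.IH[OF lt(1)] less.prems(3) by blast
  qed
qed

text \<open>
  A rung that is not a limit point has a predecessor in the closed set \<open>D \<alpha>\<close>, so by induction along
  \<open>D \<alpha>\<close> every rung becomes good for large \<open>i\<close>; the rungs are cofinal in \<open>\<alpha>\<close>.
\<close>

lemma below_exhaustive: "\<alpha> \<in> K \<Longrightarrow> \<beta> \<sqsubset> \<alpha> \<Longrightarrow> \<exists>i\<in>L. below i \<beta> \<alpha>"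
proof (induction \<alpha> arbitrary: \<beta> rule: less_induct)
  case (less \<alpha>)
  note \<alpha> = less.prems(1)
  have upper: "\<exists>k\<in>L. i \<preceq> k \<and> j \<preceq> k" if "i \<in> L" "j \<in> L" for i j
    using L.pair_bounded[OF that] L.less_imp_le by blast
  have DK: "D \<alpha> \<subseteq> K"
    using D_below[OF \<alpha>] downward[OF \<alpha>] by blast
  have eventually_good: "\<xi> \<in> D \<alpha> \<Longrightarrow> \<exists>i\<in>L. good i \<xi> \<alpha>" for \<xi>
  proof (induction \<xi> rule: less_induct)
    case (less \<xi>)
    have \<xi>: "\<xi> \<in> K" "\<xi> \<sqsubset> \<alpha>"
      using less.prems DK D_below[OF \<alpha>] by auto
    consider "limit_point (D \<alpha>) \<xi>" | "\<forall>x\<in>D \<alpha>. \<xi> \<sqsubseteq> x"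
      | y where "\<not> limit_point (D \<alpha>) \<xi>" "y \<in> D \<alpha>" "y \<sqsubset> \<xi>"
      using not_le by blast
    then show ?case
    proof cases
      case 1
      then show ?thesis
        using limit[OF \<alpha>, of "h \<alpha>"] less.prems h_in_L[OF \<alpha>] by blast
    next
      case 2
      obtain k where "k \<in> L" "h \<alpha> \<preceq> k" "h \<xi> \<preceq> k"
        using upper h_in_L \<alpha> \<xi>(1) by blast
      then show ?thesis
        using least[OF \<alpha>, of k \<xi>] 2 less.prems by blast
    next
      case (3 y)
      \<comment> \<open>The supremum \<open>m\<close> of the rungs below \<open>\<xi>\<close> is itself a rung.\<close>
      define above where "above m \<longleftrightarrow> m \<sqsubset> \<xi> \<and> (\<forall>x\<in>D \<alpha>. x \<sqsubset> \<xi> \<longrightarrow> x \<sqsubseteq> m)" for m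
      obtain m0 where "m0 \<sqsubset> \<xi>" "\<forall>x\<in>D \<alpha>. \<not> (m0 \<sqsubset> x \<and> x \<sqsubset> \<xi>)"
        using 3 unfolding limit_point_def by blast
      then have "above m0"
        using not_less unfolding above_def by blast
      then obtain m where m: "above m" "\<And>x. x \<sqsubset> m \<Longrightarrow> \<not> above x"
        using least_witness[of above] by blast
      have m_props: "m \<sqsubset> \<xi>" "m \<sqsubset> \<alpha>" "\<And>x. x \<in> D \<alpha> \<Longrightarrow> x \<sqsubset> \<xi> \<Longrightarrow> x \<sqsubseteq> m"
        using m(1) \<xi>(2) less_trans unfolding above_def by blast+
      have "m \<in> D \<alpha>"
      proof (rule ccontr)
        assume m_notin: "m \<notin> D \<alpha>"
        have "\<exists>z\<in>D \<alpha>. x \<sqsubset> z \<and> z \<sqsubset> m" if "x \<sqsubset> m" for x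
        proof -
          obtain z where z: "z \<in> D \<alpha>" "z \<sqsubset> \<xi>" "\<not> z \<sqsubseteq> x"
            using m(2)[OF \<open>x \<sqsubset> m\<close>] less_trans[OF \<open>x \<sqsubset> m\<close> m_props(1)] unfolding above_def by blast
          then have "z \<sqsubset> m" "x \<sqsubset> z"
            using m_props(3)[of z] m_notin not_le by (auto simp: less_le)
          then show ?thesis
            using z(1) by blast
        qed
        moreover have "y \<sqsubset> m"
          using m_props(3)[OF 3(2,3)] m_notin 3(2) by (auto simp: le_less)
        ultimately have "limit_point (D \<alpha>) m"
          unfolding limit_point_def by blast
        then show False
          using D_closed[OF \<alpha> m_props(2)] m_notin by blast
      qed
      then obtain i where i: "i \<in> L" "good i m \<alpha>"
        using less.IH[OF m_props(1)] by blast
      obtain j where j: "j \<in> L" "below j m \<xi>"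
        using \<open>\<And>y \<beta>. \<lbrakk>y \<sqsubset> \<alpha>; y \<in> K; \<beta> \<sqsubset> y\<rbrakk> \<Longrightarrow> \<exists>i\<in>L. below i \<beta> y\<close> \<xi> m_props(1) by blast
      obtain k where k: "k \<in> L" "i \<preceq> k" "j \<preceq> k"
        using upper i(1) j(1) by blast
      then have "good k \<xi> \<alpha>"
        using i(2) j(2) good_increasing below_increasing less.prems m_props
        by (intro step[of k m \<alpha> \<xi>]) blast+
      then show ?thesis
        using k(1) by blast
    qed
  qed
  obtain \<xi> where \<xi>: "\<xi> \<in> D \<alpha>" "\<beta> \<sqsubseteq> \<xi>"
    using D_cofinal[OF less.prems] by blast
  obtain i where i: "i \<in> L" "good i \<xi> \<alpha>"
    using eventually_good[OF \<xi>(1)] by blast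
  show ?case
  proof (cases "\<beta> = \<xi>")
    case True
    then show ?thesis
      using i base by blast
  next
    case False
    then have "\<beta> \<sqsubset> \<xi>"
      using \<xi>(2) by (simp add: less_le)
    then obtain j where j: "j \<in> L" "below j \<beta> \<xi>"
      using less.IH[of \<xi> \<beta>] \<xi>(1) D_below[OF \<alpha>] DK by blast
    obtain k where k: "k \<in> L" "i \<preceq> k" "j \<preceq> k"
      using upper i(1) j(1) by blast
    then have "below k \<beta> \<alpha>"
      using i(2) j(2) good_increasing below_increasing extend by blast
    then show ?thesis
      using k(1) by blast
  qed
qed

text \<open>
  If some good rung of \<open>\<alpha>\<close> lies beyond \<open>\<gamma>\<close>, the claim passes to that rung. If all good rungs lie before
  \<open>\<gamma>\<close>, they accumulate at \<open>\<gamma>\<close>, so \<open>\<gamma>\<close> is a limit point of \<open>D \<alpha>\<close> and hence good.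
\<close>

lemma below_closed:
  assumes "limit_point {x. below i x \<alpha>} \<gamma>" "\<gamma> \<sqsubset> \<alpha>"
  shows "below i \<gamma> \<alpha>"
  using assms
proof (induction \<alpha> rule: less_induct)
  case (less \<alpha>)
  obtain x0 where "below i x0 \<alpha>"
    using less.prems(1) unfolding limit_point_def by blast
  then have \<alpha>: "\<alpha> \<in> K" "h \<alpha> \<preceq> i"
    using below_props by blast+
  show ?case
  proof (cases "\<exists>\<eta>. good i \<eta> \<alpha> \<and> \<gamma> \<sqsubseteq> \<eta>")
    case True
    then obtain \<eta> where \<eta>: "good i \<eta> \<alpha>" "\<gamma> \<sqsubseteq> \<eta>"
      by blast
    show ?thesis
    proof (cases "\<gamma> = \<eta>")
      case False
      then have \<gamma>\<eta>: "\<gamma> \<sqsubset> \<eta>"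
        using \<eta>(2) by (simp add: less_le)
      have "below i x \<eta>" if "below i x \<alpha>" "x \<sqsubset> \<gamma>" for x
        using below_comparable[OF that(1) base[OF \<eta>(1)]] less_trans[OF that(2) \<gamma>\<eta>] by blast
      then have "limit_point {x. below i x \<eta>} \<gamma>"
        using less.prems(1) unfolding limit_point_def by blast
      then show ?thesis
        using less.IH[of \<eta>] good_props[OF \<eta>(1)] \<gamma>\<eta> extend[OF _ \<eta>(1)] by blast
    qed (use \<eta> base in blast)
  next
    case False
    have "\<exists>y\<in>D \<alpha>. x \<sqsubset> y \<and> y \<sqsubset> \<gamma>" if "x \<sqsubset> \<gamma>" for x
    proof -
      obtain z where z: "below i z \<alpha>" "x \<sqsubset> z"
        using less.prems(1) \<open>x \<sqsubset> \<gamma>\<close> unfolding limit_point_def by blast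
      then obtain \<eta> where \<eta>: "good i \<eta> \<alpha>" "z = \<eta> \<or> below i z \<eta>"
        using below_iff by blast
      then have "z \<sqsubseteq> \<eta>"
        using below_props less_imp_le by blast
      then have "x \<sqsubset> \<eta>"
        using z(2) less_le_trans by blast
      moreover have "\<eta> \<sqsubset> \<gamma>"
        using False \<eta>(1) not_le by blast
      ultimately show ?thesis
        using good_props[OF \<eta>(1)] by blast
    qed
    moreover have "\<exists>x. x \<sqsubset> \<gamma>"
      using less.prems(1) unfolding limit_point_def by blast
    ultimately have lim: "limit_point (D \<alpha>) \<gamma>"
      unfolding limit_point_def by blast
    then show ?thesis
      using limit[OF \<alpha> D_closed[OF \<alpha>(1) less.prems(2) lim] lim] base by blast
  qed
qed

text \<open>
  The ancestors of a chain are closed under limits, so every limit \<open>\<gamma>\<close> of them has \<open>h \<gamma> \<preceq> i\<close>; but the limits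
  of an unbounded set meet the stationary set of \<open>\<gamma>\<close> with \<open>i \<prec> h \<gamma>\<close>.
\<close>

lemma no_unbounded_chain:
  assumes i: "i \<in> L" and X: "X \<subseteq> K" "\<And>b. b \<in> K \<Longrightarrow> \<exists>x\<in>X. b \<sqsubset> x"
    and chain: "\<And>x y. x \<in> X \<Longrightarrow> y \<in> X \<Longrightarrow> x \<sqsubset> y \<Longrightarrow> below i x y"
  shows False
proof -
  define E where "E = {x. \<exists>y\<in>X. below i x y}"
  have "E \<subseteq> K"
    using below_props downward unfolding E_def by blast
  moreover have "X \<subseteq> E"
    using X chain unfolding E_def by blast
  ultimately have "stationary {\<gamma>\<in>{\<alpha>\<in>K. i \<prec> h \<alpha>}. limit_point E \<gamma>}"
    using X(2) by (intro stationary_limits h_stationary i) blast+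
  moreover obtain x0 where "x0 \<in> X" "x0 \<in> K"
    using X L.infinite_K infinite_K by (metis ex_in_conv finite.emptyI subsetD)
  ultimately obtain \<gamma> where \<gamma>: "\<gamma> \<in> K" "i \<prec> h \<gamma>" "limit_point E \<gamma>"
    using stationary_unbounded[of _ x0] by blast
  obtain y where y: "y \<in> X" "\<gamma> \<sqsubset> y"
    using X(2) \<gamma>(1) by blast
  have "below i z y" if z: "z \<in> E" "z \<sqsubset> \<gamma>" for z
  proof -
    obtain y' where y': "y' \<in> X" "below i z y'"
      using z(1) unfolding E_def by blast
    consider "y' = y" | "y' \<sqsubset> y" | "y \<sqsubset> y'"
      using less_linear by blast
    then show ?thesis
    proof cases
      case 2
      then show ?thesis
        using chain[OF y'(1) y(1)] y'(2) below_trans by blast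
    next
      case 3
      then show ?thesis
        using below_comparable[OF y'(2) chain[OF y(1) y'(1)]] less_trans[OF z(2) y(2)] by blast
    qed (use y' in simp)
  qed
  then have "limit_point {x. below i x y} \<gamma>"
    using \<gamma>(3) unfolding limit_point_def by blast
  then have "h \<gamma> \<preceq> i"
    using below_closed below_props y(2) by blast
  then show False
    using \<gamma>(2) L.not_le by blast
qed

end

section \<open>Pairwise incomparable families\<close>

context two_regular_cardinals
begin

lemma finite_subsets_small:
  assumes Z: "|Z| <o |K|"
  shows "|{X. X \<subseteq> Z \<and> finite X}| <o |K|"
proof -
  define F where "F n = {X. X \<subseteq> Z \<and> finite X \<and> card X = n}" for n
  have "|F n| <o |K|" for n
  proof (induction n)
    case 0
    have "F 0 = {{}}"
      by (auto simp: F_def)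
    then show ?case
      using small_finite[of "{{}}"] by simp
  next
    case (Suc n)
    have "F (Suc n) \<subseteq> (\<Union>z\<in>Z. insert z ` F n)"
    proof
      fix X assume "X \<in> F (Suc n)"
      then have X: "X \<subseteq> Z" "card X = Suc n"
        unfolding F_def by auto
      then obtain z Y where "X = insert z Y" "card Y = n" "finite Y"
        using card_Suc_eq_finite[of X n] by blast
      then show "X \<in> (\<Union>z\<in>Z. insert z ` F n)"
        using X(1) unfolding F_def by blast
    qed
    moreover have "|\<Union>z\<in>Z. insert z ` F n| <o |K|"
      using Suc.IH by (intro small_UN Z small_image)
    ultimately show ?case
      using small_subset by blast
  qed
  moreover have "|UNIV :: nat set| <o |K|"
    using L.infinite_K L_less_K infinite_iff_card_of_nat ordLeq_ordLess_trans by blast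
  ultimately have "|\<Union>n\<in>UNIV. F n| <o |K|"
    by (intro small_UN) auto
  then show ?thesis
    by (rule small_subset[rotated]) (auto simp: F_def)
qed

lemma small_L_imp_small: "|X| <o |L| \<Longrightarrow> |X| <o |K|"
  using L_less_K ordLess_transitive by blast

lemma small_times:
  assumes "|X| <o |K|" "|Y| <o |K|"
  shows "|X \<times> Y| <o |K|"
proof -
  have "X \<times> Y = (\<Union>x\<in>X. Pair x ` Y)"
    by auto
  moreover have "|\<Union>x\<in>X. Pair x ` Y| <o |K|"
    using assms by (intro small_UN small_image)
  ultimately show ?thesis
    by simp
qed

end

context coloured_ladder
begin

text \<open>
  By lemma \<open>below_closed\<close> the ancestors of each \<open>y\<close> in \<open>A\<close> are bounded below \<open>\<gamma>\<close>, and fewer than \<open>|L|\<close> such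
  bounds have a common one because of the cofinality of \<open>\<gamma>\<close>.
\<close>

lemma ancestors_bounded:
  assumes \<gamma>: "large_cof \<gamma>" and A: "|A| <o |L|"
    and y: "\<And>y. y \<in> A \<Longrightarrow> \<gamma> \<sqsubset> y \<and> \<not> below i \<gamma> y"
  shows "\<exists>\<epsilon>. \<epsilon> \<sqsubset> \<gamma> \<and> (\<forall>y\<in>A. \<forall>x. below i x y \<longrightarrow> x \<sqsubset> \<gamma> \<longrightarrow> x \<sqsubseteq> \<epsilon>)"
proof -
  have "\<exists>x. x \<sqsubset> \<gamma>"
    using \<gamma>[unfolded large_cof_def, rule_format, of "{}"] L.small_finite[of "{} :: 'a set"] by blast
  then have "\<exists>b. b \<sqsubset> \<gamma> \<and> (\<forall>x. below i x z \<longrightarrow> x \<sqsubset> \<gamma> \<longrightarrow> x \<sqsubseteq> b)" if "z \<in> A" for z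
    using below_closed[of i z \<gamma>] y[OF that] not_less unfolding limit_point_def by blast
  then have "\<forall>z\<in>A. \<exists>b. b \<sqsubset> \<gamma> \<and> (\<forall>x. below i x z \<longrightarrow> x \<sqsubset> \<gamma> \<longrightarrow> x \<sqsubseteq> b)"
    by blast
  from bchoice[OF this] obtain b
    where b: "\<And>z. z \<in> A \<Longrightarrow> b z \<sqsubset> \<gamma> \<and> (\<forall>x. below i x z \<longrightarrow> x \<sqsubset> \<gamma> \<longrightarrow> x \<sqsubseteq> b z)"
    by blast
  have "b ` A \<subseteq> {x. x \<sqsubset> \<gamma>}" "|b ` A| <o |L|"
    using b L.small_image[OF A] by auto
  then obtain \<epsilon> where "\<epsilon> \<sqsubset> \<gamma>" "\<forall>x\<in>b ` A. x \<sqsubset> \<epsilon>"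
    using \<gamma> unfolding large_cof_def by blast
  then show ?thesis
    using b le_less_trans less_imp_le by blast
qed

text \<open>
  The ordinal \<open>\<gamma>\<close> is free if some later \<open>a \<xi>\<close> has no member beyond \<open>\<xi>\<close> that equals \<open>\<gamma>\<close> or lies above it in the
  tree. If almost no \<open>\<gamma>\<close> were free, pressing down the bound from lemma \<open>ancestors_bounded\<close> would turn
  stationarily many \<open>\<gamma>\<close> into a chain. For free \<open>\<gamma>\<close> the same bound, now for \<open>a (\<xi> \<gamma>)\<close>, is pressed down to a
  constant \<open>c\<close>: relevant members of \<open>a (\<xi> \<gamma>)\<close> have no ancestors between \<open>c\<close> and \<open>\<gamma>\<close>, which is where the
  relevant members of the earlier sets are.
\<close>

lemma separated_subfamily:
  assumes i: "i \<in> L" and S: "stationary S" and cof: "\<And>\<gamma>. \<gamma> \<in> S \<Longrightarrow> large_cof \<gamma>"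
    and a: "\<And>\<gamma>. \<gamma> \<in> S \<Longrightarrow> a \<gamma> \<subseteq> K" "\<And>\<gamma>. \<gamma> \<in> S \<Longrightarrow> |a \<gamma>| <o |L|"
  obtains H where "H \<subseteq> S" "|H| =o |K|"
    "\<And>\<gamma> \<delta> x y. \<gamma> \<in> H \<Longrightarrow> \<delta> \<in> H \<Longrightarrow> \<gamma> \<noteq> \<delta> \<Longrightarrow> x \<in> a \<gamma> \<Longrightarrow> y \<in> a \<delta> \<Longrightarrow> \<gamma> \<sqsubseteq> x \<Longrightarrow> \<delta> \<sqsubseteq> y \<Longrightarrow>
      \<not> below i x y"
proof -
  have SK: "S \<subseteq> K"
    using S by (rule stationary_subset)
  define meets where "meets \<gamma> \<xi> \<longleftrightarrow> (\<exists>y\<in>a \<xi>. \<xi> \<sqsubseteq> y \<and> (\<gamma> = y \<or> below i \<gamma> y))" for \<gamma> \<xi>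
  define free where "free \<gamma> \<longleftrightarrow> (\<exists>\<xi>\<in>S. \<gamma> \<sqsubseteq> \<xi> \<and> \<not> meets \<gamma> \<xi>)" for \<gamma>
  have "stationary {\<gamma>\<in>S. free \<gamma>}"
  proof (rule ccontr)
    assume "\<not> ?thesis"
    then have S': "stationary {\<gamma>\<in>S. \<not> free \<gamma>}"
      using stationary_split[OF S] by blast
    have "\<exists>\<epsilon>. \<epsilon> \<sqsubset> \<gamma> \<and> (\<forall>y\<in>{y\<in>a \<gamma>. \<gamma> \<sqsubset> y \<and> \<not> below i \<gamma> y}. \<forall>x. below i x y \<longrightarrow> x \<sqsubset> \<gamma> \<longrightarrow> x \<sqsubseteq> \<epsilon>)"
      if "\<gamma> \<in> {\<gamma>\<in>S. \<not> free \<gamma>}" for \<gamma>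
    proof (rule ancestors_bounded)
      show "|{y\<in>a \<gamma>. \<gamma> \<sqsubset> y \<and> \<not> below i \<gamma> y}| <o |L|"
        using that by (intro L.small_subset[OF _ a(2)]) auto
    qed (use that cof in auto)
    then have "\<forall>\<gamma>\<in>{\<gamma>\<in>S. \<not> free \<gamma>}. \<exists>\<epsilon>. \<epsilon> \<sqsubset> \<gamma> \<and>
        (\<forall>y\<in>{y\<in>a \<gamma>. \<gamma> \<sqsubset> y \<and> \<not> below i \<gamma> y}. \<forall>x. below i x y \<longrightarrow> x \<sqsubset> \<gamma> \<longrightarrow> x \<sqsubseteq> \<epsilon>)"
      by blast
    from bchoice[OF this] obtain \<epsilon> where \<epsilon>: "\<And>\<gamma>. \<gamma> \<in> {\<gamma>\<in>S. \<not> free \<gamma>} \<Longrightarrow> \<epsilon> \<gamma> \<sqsubset> \<gamma> \<and>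
        (\<forall>y\<in>{y\<in>a \<gamma>. \<gamma> \<sqsubset> y \<and> \<not> below i \<gamma> y}. \<forall>x. below i x y \<longrightarrow> x \<sqsubset> \<gamma> \<longrightarrow> x \<sqsubseteq> \<epsilon> \<gamma>)"
      by blast
    have "\<exists>c\<in>K. stationary {\<gamma>\<in>{\<gamma>\<in>S. \<not> free \<gamma>}. \<epsilon> \<gamma> = c}"
      by (rule fodor[OF S']) (use \<epsilon> in blast)
    then obtain c where c: "c \<in> K" "stationary {\<gamma>\<in>{\<gamma>\<in>S. \<not> free \<gamma>}. \<epsilon> \<gamma> = c}"
      by blast
    define T where "T = {\<gamma>\<in>{\<gamma>\<in>{\<gamma>\<in>S. \<not> free \<gamma>}. \<epsilon> \<gamma> = c}. c \<sqsubset> \<gamma>}"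
    have T: "stationary T"
      unfolding T_def using c(2,1) by (rule stationary_above)
    have "below i \<gamma> \<delta>" if \<gamma>: "\<gamma> \<in> T" and \<delta>: "\<delta> \<in> T" and "\<gamma> \<sqsubset> \<delta>" for \<gamma> \<delta>
    proof -
      have "meets \<gamma> \<delta>"
        using \<gamma> \<delta> \<open>\<gamma> \<sqsubset> \<delta>\<close> less_imp_le unfolding T_def free_def by blast
      then obtain y where y: "y \<in> a \<delta>" "\<delta> \<sqsubseteq> y" "\<gamma> = y \<or> below i \<gamma> y"
        unfolding meets_def by blast
      then have \<gamma>y: "below i \<gamma> y"
        using \<open>\<gamma> \<sqsubset> \<delta>\<close> not_le by blast
      show ?thesis
      proof (cases "\<delta> = y \<or> below i \<delta> y")
        case True
        then show ?thesis
        proof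
          assume "\<delta> = y"
          then show ?thesis
            using \<gamma>y by simp
        next
          assume "below i \<delta> y"
          then show ?thesis
            by (rule below_comparable[OF \<gamma>y _ \<open>\<gamma> \<sqsubset> \<delta>\<close>])
        qed
      next
        case False
        then have "\<delta> \<sqsubset> y"
          using y(2) by (simp add: less_le)
        then have "\<gamma> \<sqsubseteq> \<epsilon> \<delta>"
          using \<epsilon>[of \<delta>] \<delta> y(1) False \<gamma>y \<open>\<gamma> \<sqsubset> \<delta>\<close> unfolding T_def by blast
        moreover have "\<epsilon> \<delta> = c" "c \<sqsubset> \<gamma>"
          using \<gamma> \<delta> unfolding T_def by blast+
        ultimately show ?thesis
          using not_le[of \<gamma> c] by simp
      qed
    qed
    then show False
      using no_unbounded_chain[OF i stationary_subset[OF T]] stationary_unbounded[OF T] by blast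
  qed
  then have S': "stationary {\<gamma>\<in>S. free \<gamma>}" (is "stationary ?S'") .
  have "\<forall>\<gamma>\<in>?S'. \<exists>\<xi>. \<xi> \<in> S \<and> \<gamma> \<sqsubseteq> \<xi> \<and> \<not> meets \<gamma> \<xi>"
    unfolding free_def by blast
  from bchoice[OF this] obtain \<xi>
    where \<xi>: "\<And>\<gamma>. \<gamma> \<in> ?S' \<Longrightarrow> \<xi> \<gamma> \<in> S \<and> \<gamma> \<sqsubseteq> \<xi> \<gamma> \<and> \<not> meets \<gamma> (\<xi> \<gamma>)"
    by blast
  have "\<exists>\<epsilon>. \<epsilon> \<sqsubset> \<gamma> \<and> (\<forall>y\<in>{y\<in>a (\<xi> \<gamma>). \<xi> \<gamma> \<sqsubseteq> y}. \<forall>x. below i x y \<longrightarrow> x \<sqsubset> \<gamma> \<longrightarrow> x \<sqsubseteq> \<epsilon>)"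
    if \<gamma>: "\<gamma> \<in> ?S'" for \<gamma>
  proof (rule ancestors_bounded)
    show "large_cof \<gamma>"
      using \<gamma> cof by blast
    show "|{y\<in>a (\<xi> \<gamma>). \<xi> \<gamma> \<sqsubseteq> y}| <o |L|"
      using \<xi>[OF \<gamma>] by (intro L.small_subset[OF _ a(2)]) auto
    fix y assume y: "y \<in> {y\<in>a (\<xi> \<gamma>). \<xi> \<gamma> \<sqsubseteq> y}"
    then have "\<gamma> \<noteq> y \<and> \<not> below i \<gamma> y"
      using \<xi>[OF \<gamma>] unfolding meets_def by blast
    moreover have "\<gamma> \<sqsubseteq> y"
      using \<xi>[OF \<gamma>] y order_trans by blast
    ultimately show "\<gamma> \<sqsubset> y \<and> \<not> below i \<gamma> y"
      by (simp add: less_le)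
  qed
  then have "\<forall>\<gamma>\<in>?S'. \<exists>\<epsilon>. \<epsilon> \<sqsubset> \<gamma> \<and>
      (\<forall>y\<in>{y\<in>a (\<xi> \<gamma>). \<xi> \<gamma> \<sqsubseteq> y}. \<forall>x. below i x y \<longrightarrow> x \<sqsubset> \<gamma> \<longrightarrow> x \<sqsubseteq> \<epsilon>)"
    by blast
  from bchoice[OF this] obtain \<epsilon> where \<epsilon>: "\<And>\<gamma>. \<gamma> \<in> ?S' \<Longrightarrow> \<epsilon> \<gamma> \<sqsubset> \<gamma> \<and>
      (\<forall>y\<in>{y\<in>a (\<xi> \<gamma>). \<xi> \<gamma> \<sqsubseteq> y}. \<forall>x. below i x y \<longrightarrow> x \<sqsubset> \<gamma> \<longrightarrow> x \<sqsubseteq> \<epsilon> \<gamma>)"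
    by blast
  have "\<exists>c\<in>K. stationary {\<gamma>\<in>?S'. \<epsilon> \<gamma> = c}"
    by (rule fodor[OF S']) (use \<epsilon> in blast)
  then obtain c where c: "c \<in> K" "stationary {\<gamma>\<in>?S'. \<epsilon> \<gamma> = c}"
    by blast
  have "\<exists>b\<in>K. \<xi> \<gamma> \<sqsubset> b \<and> (\<forall>x\<in>a (\<xi> \<gamma>). x \<sqsubset> b)" if "\<gamma> \<in> ?S'" for \<gamma>
  proof -
    have "|{\<xi> \<gamma>} \<union> a (\<xi> \<gamma>)| <o |K|"
      using \<xi>[OF that] by (intro small_Un[OF small_finite small_L_imp_small[OF a(2)]]) auto
    then show ?thesis
      using small_bounded[of "{\<xi> \<gamma>} \<union> a (\<xi> \<gamma>)"] \<xi>[OF that] a(1) SK by blast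
  qed
  then have "\<forall>\<gamma>\<in>?S'. \<exists>b. b \<in> K \<and> \<xi> \<gamma> \<sqsubset> b \<and> (\<forall>x\<in>a (\<xi> \<gamma>). x \<sqsubset> b)"
    by blast
  from bchoice[OF this] obtain b
    where b: "\<And>\<gamma>. \<gamma> \<in> ?S' \<Longrightarrow> b \<gamma> \<in> K \<and> \<xi> \<gamma> \<sqsubset> b \<gamma> \<and> (\<forall>x\<in>a (\<xi> \<gamma>). x \<sqsubset> b \<gamma>)"
    by blast
  \<comment> \<open>Closure under \<open>G\<close> puts \<open>a (\<xi> \<gamma>)\<close> entirely below the next element of the thinned-out set.\<close>
  define G where "G \<gamma> = (if \<gamma> \<in> ?S' then b \<gamma> else \<gamma>)" for \<gamma>
  have "G ` K \<subseteq> K"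
    using b unfolding G_def by auto
  define T where "T = {\<gamma>\<in>{\<gamma>\<in>{\<gamma>\<in>?S'. \<epsilon> \<gamma> = c}. c \<sqsubset> \<gamma>}. closed_under G \<gamma>}"
  have T: "stationary T"
    unfolding T_def by (intro stationary_closed stationary_above c) fact
  have TS': "T \<subseteq> ?S'"
    unfolding T_def by blast
  have b_below: "b \<gamma> \<sqsubset> \<delta>" if "\<gamma> \<in> T" "\<delta> \<in> T" "\<gamma> \<sqsubset> \<delta>" for \<gamma> \<delta>
  proof -
    have "G \<gamma> \<sqsubset> \<delta>"
      using that unfolding T_def closed_under_def by blast
    moreover have "G \<gamma> = b \<gamma>"
      using TS' that(1) unfolding G_def by (intro if_P) blast
    ultimately show ?thesis
      by simp
  qed
  show thesis
  proof (rule that[of "\<xi> ` T"])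
    show HS: "\<xi> ` T \<subseteq> S"
      using \<xi> TS' by blast
    show "|\<xi> ` T| =o |K|"
    proof (rule unbounded_card)
      show "\<xi> ` T \<subseteq> K"
        using HS SK by blast
      fix z assume "z \<in> K"
      then obtain \<gamma> where "\<gamma> \<in> T" "z \<sqsubset> \<gamma>"
        using stationary_unbounded[OF T] by blast
      then show "\<exists>x\<in>\<xi> ` T. z \<sqsubseteq> x"
        using \<xi> TS' less_imp_le order_trans by blast
    qed
  next
    fix p q x y
    assume p: "p \<in> \<xi> ` T" and q: "q \<in> \<xi> ` T" and "p \<noteq> q" and x: "x \<in> a p" "p \<sqsubseteq> x"
      and y: "y \<in> a q" "q \<sqsubseteq> y"
    obtain \<gamma> where \<gamma>: "\<gamma> \<in> T" "p = \<xi> \<gamma>"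
      using p by blast
    obtain \<delta> where \<delta>: "\<delta> \<in> T" "q = \<xi> \<delta>"
      using q by blast
    have \<gamma>S': "\<gamma> \<in> ?S'" and \<delta>S': "\<delta> \<in> ?S'"
      using \<gamma> \<delta> TS' by blast+
    have "\<gamma> \<noteq> \<delta>"
      using \<gamma> \<delta> \<open>p \<noteq> q\<close> by blast
    then consider "\<gamma> \<sqsubset> \<delta>" | "\<delta> \<sqsubset> \<gamma>"
      using less_linear by blast
    then show "\<not> below i x y"
    proof cases
      case 1
      have "x \<sqsubset> \<delta>"
        using b[OF \<gamma>S'] x(1) \<gamma>(2) b_below[OF \<gamma>(1) \<delta>(1) 1] less_trans by blast
      moreover have "c \<sqsubset> x"
        using \<xi>[OF \<gamma>S'] x(2) \<gamma> less_le_trans order_trans unfolding T_def by blast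
      moreover have "x \<sqsubseteq> c" if "below i x y"
        using \<epsilon>[OF \<delta>S'] y \<delta> that calculation(1) unfolding T_def by blast
      ultimately show ?thesis
        using not_le by blast
    next
      case 2
      have "y \<sqsubset> \<gamma>"
        using b[OF \<delta>S'] y(1) \<delta>(2) b_below[OF \<delta>(1) \<gamma>(1) 2] less_trans by blast
      moreover have "\<gamma> \<sqsubseteq> x"
        using \<xi>[OF \<gamma>S'] x(2) \<gamma>(2) order_trans by blast
      ultimately have "y \<sqsubset> x"
        by (rule less_le_trans)
      then show ?thesis
        using below_props less_asym by blast
    qed
  qed
qed

end

section \<open>The forcing of finite antichains and its powers\<close>

text \<open>
  The pairs \<open>(i, \<alpha>)\<close> are coded by elements of \<open>'a\<close>, so that a condition is a set over \<open>'a\<close>.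
\<close>

locale coded_ladder = coloured_ladder le lt K leL ltL L D h
  for le :: "'a \<Rightarrow> 'a \<Rightarrow> bool" (infix \<open>\<sqsubseteq>\<close> 50) and lt :: "'a \<Rightarrow> 'a \<Rightarrow> bool" (infix \<open>\<sqsubset>\<close> 50)
    and K :: "'a set"
    and leL :: "'b \<Rightarrow> 'b \<Rightarrow> bool" (infix \<open>\<preceq>\<close> 50) and ltL :: "'b \<Rightarrow> 'b \<Rightarrow> bool" (infix \<open>\<prec>\<close> 50)
    and L :: "'b set" and D h +
  fixes code :: "'b \<times> 'a \<Rightarrow> 'a"
  assumes code_inj: "inj_on code (L \<times> K)"
begin

text \<open>
  The finite-support product, over \<open>i\<close> in \<open>L\<close>, of the posets of finite antichains of \<open>below i\<close>.
\<close>

definition conditions :: "'a set set" where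
  "conditions = {X. finite X \<and> X \<subseteq> code ` (L \<times> K) \<and>
    (\<forall>i\<in>L. \<forall>\<alpha>\<in>K. \<forall>\<beta>\<in>K. code (i, \<alpha>) \<in> X \<longrightarrow> code (i, \<beta>) \<in> X \<longrightarrow> \<not> below i \<alpha> \<beta>)}"

definition forcing :: "'a set rel" where
  "forcing = {(X, Y). X \<in> conditions \<and> Y \<in> conditions \<and> Y \<subseteq> X}"

lemma Field_forcing: "Field forcing = conditions"
  unfolding forcing_def Field_def by auto

lemma Partial_order_forcing: "Partial_order forcing"
  unfolding partial_order_on_def preorder_on_def refl_on_def trans_def antisym_def Field_forcing
  unfolding forcing_def by auto

lemma full_power_forcing_iff:
  "(f, g) \<in> full_power forcing \<mu> \<longleftrightarrow>
    f \<in> Func (Field \<mu>) conditions \<and> g \<in> Func (Field \<mu>) conditions \<and> (\<forall>j\<in>Field \<mu>. g j \<subseteq> f j)"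
proof -
  have "(X, Y) \<in> forcing \<longleftrightarrow> X \<in> conditions \<and> Y \<in> conditions \<and> Y \<subseteq> X" for X Y
    unfolding forcing_def by blast
  then show ?thesis
    unfolding full_power_def Field_forcing Func_def by auto
qed

lemma Field_full_power_forcing: "Field (full_power forcing \<mu>) = Func (Field \<mu>) conditions"
proof
  show "Field (full_power forcing \<mu>) \<subseteq> Func (Field \<mu>) conditions"
  proof
    fix f assume "f \<in> Field (full_power forcing \<mu>)"
    then obtain g where "(f, g) \<in> full_power forcing \<mu> \<or> (g, f) \<in> full_power forcing \<mu>"
      unfolding Field_def by blast
    then show "f \<in> Func (Field \<mu>) conditions"
      unfolding full_power_forcing_iff by blast
  qed
  show "Func (Field \<mu>) conditions \<subseteq> Field (full_power forcing \<mu>)"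
  proof
    fix f assume "f \<in> Func (Field \<mu>) conditions"
    then have "(f, f) \<in> full_power forcing \<mu>"
      unfolding full_power_forcing_iff by blast
    then show "f \<in> Field (full_power forcing \<mu>)"
      by (rule FieldI1)
  qed
qed

lemma compatible_if_union:
  assumes "f \<in> Func (Field \<mu>) conditions" "g \<in> Func (Field \<mu>) conditions"
    "\<And>j. j \<in> Field \<mu> \<Longrightarrow> f j \<union> g j \<in> conditions"
  shows "compatible (full_power forcing \<mu>) f g"
proof -
  define r where "r j = (if j \<in> Field \<mu> then f j \<union> g j else undefined)" for j
  have "r \<in> Func (Field \<mu>) conditions"
    using assms(3) unfolding r_def Func_def by auto
  then have "(r, f) \<in> full_power forcing \<mu>" "(r, g) \<in> full_power forcing \<mu>"
    using assms unfolding full_power_forcing_iff by (auto simp: r_def)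
  then show ?thesis
    unfolding compatible_def by (metis FieldI1)
qed

text \<open>
  The sequences that place \<open>\<alpha>\<close> in the \<open>i\<close>-th tree at coordinate \<open>i\<close>, for \<open>\<alpha>\<close> in \<open>K\<close>, form an antichain, because two
  ordinals are comparable in one of the trees.
\<close>

lemma power_not_chain_condition:
  assumes \<kappa>: "|K| =o \<kappa>" and lam: "Field lam = L"
  shows "\<not> chain_condition \<kappa> (full_power forcing lam)"
proof -
  define f where "f \<alpha> = (\<lambda>i. if i \<in> L then {code (i, \<alpha>)} else undefined)" for \<alpha>
  obtain i0 where i0: "i0 \<in> L"
    using L.infinite_K by (metis ex_in_conv finite.emptyI)
  have code_eq: "code (i, \<alpha>) = code (j, \<beta>) \<longleftrightarrow> i = j \<and> \<alpha> = \<beta>"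
    if "i \<in> L" "j \<in> L" "\<alpha> \<in> K" "\<beta> \<in> K" for i j \<alpha> \<beta>
    using that inj_on_eq_iff[OF code_inj, of "(i, \<alpha>)" "(j, \<beta>)"] by auto
  have "{code (i, \<alpha>)} \<in> conditions" if "i \<in> L" "\<alpha> \<in> K" for i \<alpha>
  proof -
    have "\<not> below k \<beta> \<beta>" for k \<beta>
      using below_props less_irrefl by blast
    then show ?thesis
      unfolding conditions_def using that code_eq by auto
  qed
  then have "f ` K \<subseteq> Field (full_power forcing lam)"
    unfolding Field_full_power_forcing lam f_def Func_def by auto
  moreover have "inj_on f K"
  proof (rule inj_onI)
    fix \<alpha> \<beta> assume "\<alpha> \<in> K" "\<beta> \<in> K" "f \<alpha> = f \<beta>"
    then show "\<alpha> = \<beta>"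
      using fun_cong[of "f \<alpha>" "f \<beta>" i0] code_eq i0 unfolding f_def by simp
  qed
  then have "|f ` K| =o \<kappa>"
    using \<kappa> card_of_ordIso[of K "f ` K"] inj_on_imp_bij_betw ordIso_symmetric ordIso_transitive by blast
  moreover have "\<not> compatible (full_power forcing lam) (f \<alpha>) (f \<beta>)"
    if "\<alpha> \<in> K" "\<beta> \<in> K" "\<alpha> \<noteq> \<beta>" for \<alpha> \<beta>
  proof
    assume "compatible (full_power forcing lam) (f \<alpha>) (f \<beta>)"
    then obtain r where r: "(r, f \<alpha>) \<in> full_power forcing lam" "(r, f \<beta>) \<in> full_power forcing lam"
      unfolding compatible_def by blast
    have rc: "r i \<in> conditions" "code (i, \<alpha>) \<in> r i" "code (i, \<beta>) \<in> r i" if "i \<in> L" for i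
      using r that unfolding full_power_forcing_iff lam Func_def f_def by auto
    obtain i where "i \<in> L" "below i \<alpha> \<beta> \<or> below i \<beta> \<alpha>"
      using below_exhaustive[of \<alpha> \<beta>] below_exhaustive[of \<beta> \<alpha>] less_linear[of \<alpha> \<beta>] \<open>\<alpha> \<in> K\<close>
        \<open>\<beta> \<in> K\<close> \<open>\<alpha> \<noteq> \<beta>\<close> by blast
    then show False
      using rc[OF \<open>i \<in> L\<close>] \<open>\<alpha> \<in> K\<close> \<open>\<beta> \<in> K\<close> unfolding conditions_def by blast
  qed
  then have "pairwise (\<lambda>p q. \<not> compatible (full_power forcing lam) p q) (f ` K)"
    unfolding pairwise_def by blast
  ultimately show ?thesis
    unfolding chain_condition_def by blast
qed

text \<open>
  The bound \<open>k\<close> of the indices, the bound \<open>c\<close> of the ordinals below \<open>\<gamma>\<close> and the trace of the condition below \<open>c\<close> are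
  made constant in this order; only the trace, a function from \<open>\<mu>\<close> to finite subsets of a small set, uses the
  hypothesis on cardinal powers. A comparability between two conditions with the same trace must then
  involve ordinals beyond \<open>\<gamma>\<close> and \<open>\<delta>\<close>, and it persists to the tree \<open>below k\<close>.
\<close>

lemma power_knaster:
  fixes \<mu> :: "'c rel"
  assumes \<kappa>: "|K| =o \<kappa>" and \<mu>: "|Field \<mu>| <o |L|"
    and pow: "\<And>W :: 'a set set. |W| <o |K| \<Longrightarrow> |Func (Field \<mu>) W| <o |K|"
  shows "knaster \<kappa> (full_power forcing \<mu>)"
  unfolding knaster_def
proof (intro allI impI)
  fix A assume "A \<subseteq> Field (full_power forcing \<mu>)" and "|A| =o \<kappa>"
  then have A: "A \<subseteq> Func (Field \<mu>) conditions"
    by (simp add: Field_full_power_forcing)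
  have "|K| =o |A|"
    using \<kappa> \<open>|A| =o \<kappa>\<close> ordIso_symmetric ordIso_transitive by blast
  then obtain F where F: "bij_betw F K A"
    using card_of_ordIso by blast
  then have F_inj: "inj_on F K" and F_Func: "\<And>\<gamma>. \<gamma> \<in> K \<Longrightarrow> F \<gamma> \<in> Func (Field \<mu>) conditions"
    using A unfolding bij_betw_def by auto
  have F_cond: "F \<gamma> j \<in> conditions" if "\<gamma> \<in> K" "j \<in> Field \<mu>" for \<gamma> j
    using F_Func[OF that(1)] that(2) unfolding Func_def by blast
  define decode where "decode = inv_into (L \<times> K) code"
  have decode: "decode (code (i, \<alpha>)) = (i, \<alpha>)" if "i \<in> L" "\<alpha> \<in> K" for i \<alpha>
    using code_inj that unfolding decode_def by simp
  define supp where "supp \<gamma> = (\<Union>j\<in>Field \<mu>. F \<gamma> j)" for \<gamma>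
  define a where "a \<gamma> = (snd \<circ> decode) ` supp \<gamma>" for \<gamma>
  have supp_small: "|supp \<gamma>| <o |L|" if "\<gamma> \<in> K" for \<gamma>
    unfolding supp_def using F_cond[OF that]
    by (intro L.small_UN \<mu> L.small_finite) (auto simp: conditions_def)
  have supp_code: "supp \<gamma> \<subseteq> code ` (L \<times> K)" if "\<gamma> \<in> K" for \<gamma>
    unfolding supp_def using F_cond[OF that] by (auto simp: conditions_def)
  have a_small: "|a \<gamma>| <o |L|" if "\<gamma> \<in> K" for \<gamma>
    unfolding a_def using supp_small[OF that] by (rule L.small_image)
  have a_K: "a \<gamma> \<subseteq> K" if "\<gamma> \<in> K" for \<gamma>
    using supp_code[OF that] decode unfolding a_def by auto
  have "\<exists>i\<in>L. \<forall>x\<in>supp \<gamma>. (fst \<circ> decode) x \<prec> i" if "\<gamma> \<in> K" for \<gamma>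
    using supp_code[OF that] decode by (intro L.family_bounded supp_small that) auto
  then obtain i where i: "\<And>\<gamma>. \<gamma> \<in> K \<Longrightarrow> i \<gamma> \<in> L \<and> (\<forall>x\<in>supp \<gamma>. (fst \<circ> decode) x \<prec> i \<gamma>)"
    by metis
  have "\<exists>k\<in>L. stationary {\<gamma>\<in>{\<gamma>\<in>K. large_cof \<gamma>}. i \<gamma> = k}"
    using i by (intro stationary_partition stationary_large_cof L_less_K) auto
  then obtain k where k: "k \<in> L" and S1: "stationary {\<gamma>\<in>{\<gamma>\<in>K. large_cof \<gamma>}. i \<gamma> = k}"
    (is "stationary ?S1")
    by blast
  have "\<exists>b. b \<sqsubset> \<gamma> \<and> (\<forall>x\<in>a \<gamma>. x \<sqsubset> \<gamma> \<longrightarrow> x \<sqsubset> b)" if "\<gamma> \<in> ?S1" for \<gamma>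
  proof -
    have "|a \<gamma> \<inter> {x. x \<sqsubset> \<gamma>}| <o |L|"
      using that by (intro L.small_subset[OF _ a_small]) auto
    moreover have "large_cof \<gamma>"
      using that by blast
    ultimately obtain b where "b \<sqsubset> \<gamma>" "\<forall>x\<in>a \<gamma> \<inter> {x. x \<sqsubset> \<gamma>}. x \<sqsubset> b"
      unfolding large_cof_def by (meson Int_lower2)
    then show ?thesis
      by blast
  qed
  then have "\<forall>\<gamma>\<in>?S1. \<exists>b. b \<sqsubset> \<gamma> \<and> (\<forall>x\<in>a \<gamma>. x \<sqsubset> \<gamma> \<longrightarrow> x \<sqsubset> b)"
    by blast
  from bchoice[OF this] obtain b
    where b: "\<And>\<gamma>. \<gamma> \<in> ?S1 \<Longrightarrow> b \<gamma> \<sqsubset> \<gamma> \<and> (\<forall>x\<in>a \<gamma>. x \<sqsubset> \<gamma> \<longrightarrow> x \<sqsubset> b \<gamma>)"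
    by blast
  have "\<exists>c\<in>K. stationary {\<gamma>\<in>?S1. b \<gamma> = c}"
    by (rule fodor[OF S1]) (use b in blast)
  then obtain c where c: "c \<in> K" and S2: "stationary {\<gamma>\<in>?S1. b \<gamma> = c}" (is "stationary ?S2")
    by blast
  define Z where "Z = code ` (L \<times> {x. x \<sqsubset> c})"
  define trace where "trace \<gamma> = (\<lambda>j. if j \<in> Field \<mu> then F \<gamma> j \<inter> Z else undefined)" for \<gamma>
  have "|Z| <o |K|"
    unfolding Z_def by (intro small_image small_times L_less_K segment_small c)
  then have "|Func (Field \<mu>) {X. X \<subseteq> Z \<and> finite X}| <o |K|"
    by (intro pow finite_subsets_small)
  moreover have "trace \<gamma> \<in> Func (Field \<mu>) {X. X \<subseteq> Z \<and> finite X}" if "\<gamma> \<in> K" for \<gamma>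
    using F_cond[OF that] unfolding trace_def Func_def conditions_def by auto
  ultimately have "\<exists>t\<in>Func (Field \<mu>) {X. X \<subseteq> Z \<and> finite X}. stationary {\<gamma>\<in>?S2. trace \<gamma> = t}"
    by (intro stationary_partition S2) auto
  then obtain t where S3: "stationary {\<gamma>\<in>?S2. trace \<gamma> = t}" (is "stationary ?S3")
    by blast
  obtain H where H: "H \<subseteq> ?S3" "|H| =o |K|"
    "\<And>\<gamma> \<delta> x y. \<gamma> \<in> H \<Longrightarrow> \<delta> \<in> H \<Longrightarrow> \<gamma> \<noteq> \<delta> \<Longrightarrow> x \<in> a \<gamma> \<Longrightarrow> y \<in> a \<delta> \<Longrightarrow> \<gamma> \<sqsubseteq> x \<Longrightarrow> \<delta> \<sqsubseteq> y \<Longrightarrow>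
      \<not> below k x y"
    by (rule separated_subfamily[OF k S3, of a]) (use a_K a_small in auto)
  have HK: "H \<subseteq> K"
    using H(1) by blast
  have no_cross: "\<not> below l \<alpha> \<beta>"
    if \<gamma>\<delta>: "\<gamma> \<in> H" "\<delta> \<in> H" "\<gamma> \<noteq> \<delta>" and j: "j \<in> Field \<mu>" and l: "l \<in> L" "\<alpha> \<in> K" "\<beta> \<in> K"
      and in_F: "code (l, \<alpha>) \<in> F \<gamma> j" "code (l, \<beta>) \<in> F \<delta> j" for \<gamma> \<delta> j l \<alpha> \<beta>
  proof
    assume below: "below l \<alpha> \<beta>"
    have \<gamma>K: "\<gamma> \<in> K" and \<delta>K: "\<delta> \<in> K"
      using \<gamma>\<delta> HK by blast+
    have "trace \<gamma> = trace \<delta>"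
      using \<gamma>\<delta> H(1) by blast
    then have traces: "F \<gamma> j \<inter> Z = F \<delta> j \<inter> Z"
      using fun_cong[of "trace \<gamma>" "trace \<delta>" j] j unfolding trace_def by simp
    \<comment> \<open>Below \<open>c\<close> the traces agree, and the comparability would occur within a single condition.\<close>
    have "\<not> \<alpha> \<sqsubset> c"
    proof
      assume "\<alpha> \<sqsubset> c"
      then have "code (l, \<alpha>) \<in> F \<delta> j"
        using traces in_F(1) l(1) unfolding Z_def by blast
      then show False
        using F_cond[OF \<delta>K j] in_F(2) below l unfolding conditions_def by blast
    qed
    moreover have "\<not> \<beta> \<sqsubset> c"
    proof
      assume "\<beta> \<sqsubset> c"
      then have "code (l, \<beta>) \<in> F \<gamma> j"
        using traces in_F(2) l(1) unfolding Z_def by blast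
      then show False
        using F_cond[OF \<gamma>K j] in_F(1) below l unfolding conditions_def by blast
    qed
    moreover have supp: "code (l, \<alpha>) \<in> supp \<gamma>" "code (l, \<beta>) \<in> supp \<delta>"
      using in_F j unfolding supp_def by blast+
    then have a: "\<alpha> \<in> a \<gamma>" "\<beta> \<in> a \<delta>"
      using decode l unfolding a_def by force+
    ultimately have "\<gamma> \<sqsubseteq> \<alpha>" "\<delta> \<sqsubseteq> \<beta>"
      using b[of \<gamma>] b[of \<delta>] \<gamma>\<delta> H(1) not_less by blast+
    then have "\<not> below k \<alpha> \<beta>"
      using H(3)[OF \<gamma>\<delta> a] by blast
    moreover have "l \<prec> k"
      using i[OF \<gamma>K] supp(1) decode[OF l(1,2)] \<gamma>\<delta>(1) H(1) by fastforce
    ultimately show False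
      using below_increasing[OF L.less_imp_le below] by blast
  qed
  have "compatible (full_power forcing \<mu>) (F \<gamma>) (F \<delta>)" if "\<gamma> \<in> H" "\<delta> \<in> H" "\<gamma> \<noteq> \<delta>" for \<gamma> \<delta>
  proof (rule compatible_if_union)
    show "F \<gamma> \<in> Func (Field \<mu>) conditions" "F \<delta> \<in> Func (Field \<mu>) conditions"
      using F_Func that HK by blast+
    fix j assume j: "j \<in> Field \<mu>"
    have "F \<gamma> j \<in> conditions" "F \<delta> j \<in> conditions"
      using F_cond j that HK by blast+
    then show "F \<gamma> j \<union> F \<delta> j \<in> conditions"
      using no_cross[OF that j] no_cross[OF that(2,1) that(3)[symmetric] j]
      unfolding conditions_def by blast
  qed
  then have "pairwise (compatible (full_power forcing \<mu>)) (F ` H)"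
    unfolding pairwise_def by blast
  moreover have "F ` H \<subseteq> A"
    using F HK unfolding bij_betw_def by blast
  moreover have "|F ` H| =o \<kappa>"
  proof -
    have "bij_betw F H (F ` H)"
      using F_inj HK by (meson inj_on_imp_bij_betw inj_on_subset)
    then have "|F ` H| =o |H|"
      using card_of_ordIso ordIso_symmetric by blast
    then show ?thesis
      by (rule ordIso_transitive[OF _ ordIso_transitive[OF H(2) \<kappa>]])
  qed
  ultimately show "\<exists>B\<subseteq>A. |B| =o \<kappa> \<and> pairwise (compatible (full_power forcing \<mu>)) B"
    by blast
qed

end

section \<open>From cardinals as relations to initial segments of well-ordered types\<close>

text \<open>
  Points outside the field of \<open>r\<close> are placed on top, ordered by an arbitrary well-order of the type.
\<close>

lemma initial_segment_of_wellorder: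
  fixes r :: "'a rel"
  assumes r: "Well_order r"
  obtains le lt where "class.wellorder le lt" "\<And>x y. x \<in> Field r \<Longrightarrow> le y x \<longleftrightarrow> (y, x) \<in> r"
proof -
  obtain s :: "'a rel" where s: "well_order_on UNIV s"
    using well_order_on by blast
  define F where "F = Field r"
  define le where "le x y \<longleftrightarrow> (if y \<in> F then (x, y) \<in> r else x \<in> F \<or> (x, y) \<in> s)" for x y
  define lt where "lt x y \<longleftrightarrow> le x y \<and> \<not> le y x" for x y
  interpret r: wo_rel r
    using r by (simp add: wo_rel_def)
  interpret s: wo_rel s
    using s well_order_on_Well_order by (auto simp: wo_rel_def)
  have s_Field: "Field s = UNIV"
    using s well_order_on_Field by blast
  have r_Field: "x \<in> F \<and> y \<in> F" if "(x, y) \<in> r" for x y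
    using that FieldI1 FieldI2 unfolding F_def by fast
  have r_refl: "(x, x) \<in> r" if "x \<in> F" for x
    using r.REFL that unfolding refl_on_def F_def by blast
  have r_trans: "(x, z) \<in> r" if "(x, y) \<in> r" "(y, z) \<in> r" for x y z
    using r.TRANS that by (rule transD)
  have r_antisym: "x = y" if "(x, y) \<in> r" "(y, x) \<in> r" for x y
    using r.ANTISYM that by (rule antisymD)
  have r_total: "(x, y) \<in> r \<or> (y, x) \<in> r" if "x \<in> F" "y \<in> F" for x y
    using r.TOTALS that unfolding F_def by blast
  have s_refl: "(x, x) \<in> s" for x
    using s.REFL s_Field unfolding refl_on_def by blast
  have s_trans: "(x, z) \<in> s" if "(x, y) \<in> s" "(y, z) \<in> s" for x y z
    using s.TRANS that by (rule transD)
  have s_antisym: "x = y" if "(x, y) \<in> s" "(y, x) \<in> s" for x y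
    using s.ANTISYM that by (rule antisymD)
  have s_total: "(x, y) \<in> s \<or> (y, x) \<in> s" for x y
    using s.TOTALS s_Field by blast
  have "class.wellorder le lt"
  proof
    show "lt x y \<longleftrightarrow> le x y \<and> \<not> le y x" for x y
      by (rule lt_def)
    show "le x x" for x
      using r_refl s_refl by (simp add: le_def)
    show "le x z" if "le x y" "le y z" for x y z
      using that r_trans[of x y z] s_trans[of x y z] r_Field[of y z] r_Field[of x y]
      unfolding le_def by (cases "x \<in> F"; cases "y \<in> F"; cases "z \<in> F") simp_all
    show "x = y" if "le x y" "le y x" for x y
      using that r_antisym[of x y] s_antisym[of x y] r_Field[of x y] r_Field[of y x]
      unfolding le_def by (cases "x \<in> F"; cases "y \<in> F") simp_all
    show "le x y \<or> le y x" for x y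
      using r_total[of x y] s_total[of x y] by (auto simp: le_def)
  next
    fix P and a :: 'a
    assume IH: "\<And>x. (\<And>y. lt y x \<Longrightarrow> P y) \<Longrightarrow> P x"
    have inside: "x \<in> F \<longrightarrow> P x" for x
      using r.WF
    proof (induction x rule: wf_induct_rule)
      case (less x)
      show ?case
      proof
        assume "x \<in> F"
        then have "(y, x) \<in> r - Id \<and> y \<in> F" if "lt y x" for y
          using that r_Field r_refl by (auto simp: lt_def le_def split: if_splits)
        then show "P x"
          using IH less.IH by blast
      qed
    qed
    show "P a"
      using s.WF
    proof (induction a rule: wf_induct_rule)
      case (less x)
      show ?case
      proof (cases "x \<in> F")
        case False
        then have "y \<in> F \<or> (y, x) \<in> s - Id" if "lt y x" for y
          using that s_refl by (auto simp: lt_def le_def split: if_splits)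
        then show ?thesis
          using IH less.IH inside by blast
      qed (use inside in blast)
    qed
  qed
  then show thesis
    by (rule that) (simp add: le_def F_def)
qed

lemma regular_cardinal_Field:
  assumes r: "Card_order r" "cinfinite r" "regularCard r"
    and wo: "class.wellorder le lt" and le: "\<And>x y. x \<in> Field r \<Longrightarrow> le y x \<longleftrightarrow> (y, x) \<in> r"
  shows "regular_cardinal le lt (Field r)"
proof -
  interpret wellorder le lt
    by (rule wo)
  have iso: "r =o |Field r|"
    using r(1) card_of_Field_ordIso ordIso_symmetric by blast
  show ?thesis
  proof
    show "y \<in> Field r" if "x \<in> Field r" "lt y x" for x y
      using le[OF that(1), of y] that(2) less_imp_le FieldI1 by fast
    show "|{y. lt y x}| <o |Field r|" if "x \<in> Field r" for x
    proof -
      have "{y. lt y x} = underS r x"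
        using le[OF that] unfolding underS_def by (auto simp: less_le)
      then show ?thesis
        using card_of_underS[OF r(1) that] iso ordLess_ordIso_trans by metis
    qed
    show "stable |Field r|"
      using regularCard_stable[OF r(1) _ r(3)] r(2) stable_ordIso1[OF _ ordIso_symmetric[OF iso]]
      unfolding cinfinite_def by blast
    show "infinite (Field r)"
      using r(2) unfolding cinfinite_def .
  qed
qed

context regular_cardinal
begin

text \<open>
  The supremum of \<open>A \<inter> \<alpha>\<close> is the least upper bound in \<open>\<kappa>\<close>. It exists because \<open>\<alpha>\<close> is an upper bound, and
  it equals \<open>\<alpha>\<close> exactly if no smaller ordinal is one.
\<close>

lemma limit_of_iff_limit_point:
  assumes \<kappa>: "Well_order \<kappa>" "K = Field \<kappa>"
    and le: "\<And>x y. x \<in> K \<Longrightarrow> y \<sqsubseteq> x \<longleftrightarrow> (y, x) \<in> \<kappa>" and \<alpha>: "\<alpha> \<in> K"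
  shows "limit_of \<kappa> A \<alpha> \<longleftrightarrow> limit_point A \<alpha>"
proof -
  interpret \<kappa>: wo_rel \<kappa>
    using \<kappa>(1) by (simp add: wo_rel_def)
  have underS: "y \<in> underS \<kappa> \<alpha> \<longleftrightarrow> y \<sqsubset> \<alpha>" for y
    using le[OF \<alpha>] unfolding underS_def by (auto simp: less_le)
  define X where "X = A \<inter> underS \<kappa> \<alpha>"
  have X: "x \<in> X \<longleftrightarrow> x \<in> A \<and> x \<sqsubset> \<alpha>" for x
    using underS unfolding X_def by blast
  have Above: "b \<in> Above \<kappa> X \<longleftrightarrow> b \<in> K \<and> (\<forall>x\<in>X. x \<sqsubseteq> b)" for b
    using le unfolding Above_def \<kappa>(2) by blast
  have Above_Field: "Above \<kappa> X \<subseteq> Field \<kappa>"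
    unfolding Above_def by blast
  have \<alpha>_Above: "\<alpha> \<in> Above \<kappa> X"
    using Above \<alpha> X less_imp_le by blast
  have "\<kappa>.supr X = \<alpha> \<longleftrightarrow> (\<forall>b. b \<sqsubset> \<alpha> \<longrightarrow> b \<notin> Above \<kappa> X)"
  proof
    assume sup: "\<kappa>.supr X = \<alpha>"
    show "\<forall>b. b \<sqsubset> \<alpha> \<longrightarrow> b \<notin> Above \<kappa> X"
    proof (intro allI impI notI)
      fix b assume b: "b \<sqsubset> \<alpha>" "b \<in> Above \<kappa> X"
      then have "(\<alpha>, b) \<in> \<kappa>"
        using \<kappa>.minim_least[OF Above_Field b(2)] sup unfolding \<kappa>.supr_def by simp
      then show False
        using le[OF downward[OF \<alpha> b(1)]] b(1) not_le by blast
    qed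
  next
    assume *: "\<forall>b. b \<sqsubset> \<alpha> \<longrightarrow> b \<notin> Above \<kappa> X"
    have "(\<alpha>, b) \<in> \<kappa>" if "b \<in> Above \<kappa> X" for b
      using * that Above le[of b \<alpha>] not_less by blast
    then show "\<kappa>.supr X = \<alpha>"
      using \<kappa>.equals_minim[OF Above_Field \<alpha>_Above] unfolding \<kappa>.supr_def by simp
  qed
  also have "\<dots> \<longleftrightarrow> (\<forall>b. b \<sqsubset> \<alpha> \<longrightarrow> (\<exists>y\<in>A. b \<sqsubset> y \<and> y \<sqsubset> \<alpha>))"
  proof -
    have "b \<notin> Above \<kappa> X \<longleftrightarrow> (\<exists>y\<in>A. b \<sqsubset> y \<and> y \<sqsubset> \<alpha>)" if "b \<sqsubset> \<alpha>" for b
      using Above[of b] downward[OF \<alpha> that] X not_le[of _ b] by blast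
    then show ?thesis
      by blast
  qed
  finally show ?thesis
    using underS unfolding limit_of_def limit_point_def X_def by auto
qed

end

context two_regular_cardinals
begin

lemma square_sequence_if_square_seq:
  assumes \<kappa>: "Well_order \<kappa>" "K = Field \<kappa>"
    and le: "\<And>x y. x \<in> K \<Longrightarrow> y \<sqsubseteq> x \<longleftrightarrow> (y, x) \<in> \<kappa>" and C: "square_seq \<kappa> C"
  shows "square_sequence (\<sqsubseteq>) (\<sqsubset>) K (\<preceq>) (\<prec>) L C"
proof -
  have limit_iff: "limit_of \<kappa> A \<alpha> \<longleftrightarrow> limit_point A \<alpha>" if "\<alpha> \<in> K" for A \<alpha>
    using limit_of_iff_limit_point[OF \<kappa>, of \<alpha>] le that by blast
  have underS: "underS \<kappa> \<alpha> = {x. x \<sqsubset> \<alpha>}" if "\<alpha> \<in> K" for \<alpha>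
    using le[OF that] unfolding underS_def by (auto simp: less_le)
  have acc_K: "\<alpha> \<in> acc \<kappa> (Field \<kappa>) \<longleftrightarrow> \<alpha> \<in> K \<and> is_limit \<alpha>" for \<alpha>
  proof -
    have "limit_point K \<alpha> \<longleftrightarrow> is_limit \<alpha>" if "\<alpha> \<in> K"
      using downward[OF that] unfolding limit_point_def by blast
    then show ?thesis
      using limit_iff unfolding acc_def \<kappa>(2)[symmetric] by blast
  qed
  have acc: "\<alpha> \<in> acc \<kappa> A \<longleftrightarrow> \<alpha> \<in> A \<and> limit_point A \<alpha>" if "\<alpha> \<in> K" for \<alpha> A
    using limit_iff[OF that] unfolding acc_def by blast
  have club: "C \<alpha> \<subseteq> {x. x \<sqsubset> \<alpha>}" "\<And>\<beta>. \<beta> \<sqsubset> \<alpha> \<Longrightarrow> \<exists>\<gamma>\<in>C \<alpha>. \<beta> \<sqsubseteq> \<gamma>"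
    "\<And>\<beta>. \<beta> \<sqsubset> \<alpha> \<Longrightarrow> limit_point (C \<alpha>) \<beta> \<Longrightarrow> \<beta> \<in> C \<alpha>"
    if \<alpha>: "\<alpha> \<in> K" "is_limit \<alpha>" for \<alpha>
  proof -
    have *: "club_in \<kappa> (underS \<kappa> \<alpha>) (C \<alpha>)"
      using C \<alpha> acc_K unfolding square_seq_def by blast
    show below: "C \<alpha> \<subseteq> {x. x \<sqsubset> \<alpha>}"
      using * underS[OF \<alpha>(1)] unfolding club_in_def by blast
    show "\<exists>\<gamma>\<in>C \<alpha>. \<beta> \<sqsubseteq> \<gamma>" if "\<beta> \<sqsubset> \<alpha>" for \<beta>
    proof -
      have "\<beta> \<in> underS \<kappa> \<alpha>"
        using \<open>\<beta> \<sqsubset> \<alpha>\<close> underS[OF \<alpha>(1)] by simp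
      then obtain \<gamma> where \<gamma>: "\<gamma> \<in> C \<alpha>" "(\<beta>, \<gamma>) \<in> \<kappa>"
        using * unfolding club_in_def by blast
      then show ?thesis
        using le[of \<gamma> \<beta>] below downward[OF \<alpha>(1)] by blast
    qed
    show "\<beta> \<in> C \<alpha>" if "\<beta> \<sqsubset> \<alpha>" "limit_point (C \<alpha>) \<beta>" for \<beta>
      using * underS[OF \<alpha>(1)] that limit_iff[OF downward[OF \<alpha>(1) that(1)]] unfolding club_in_def
      by blast
  qed
  show ?thesis
  proof
    show "C \<alpha> \<subseteq> {x. x \<sqsubset> \<alpha>}" if "\<alpha> \<in> K" "is_limit \<alpha>" for \<alpha>
      using club(1)[OF that] .
    show "limit_point (C \<alpha>) \<alpha>" if \<alpha>: "\<alpha> \<in> K" "is_limit \<alpha>" for \<alpha>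
    proof -
      have "\<exists>y\<in>C \<alpha>. x \<sqsubset> y \<and> y \<sqsubset> \<alpha>" if "x \<sqsubset> \<alpha>" for x
      proof -
        obtain x' where x': "x \<sqsubset> x'" "x' \<sqsubset> \<alpha>"
          using \<alpha>(2) \<open>x \<sqsubset> \<alpha>\<close> unfolding limit_point_def by blast
        then obtain y where "y \<in> C \<alpha>" "x' \<sqsubseteq> y"
          using club(2)[OF \<alpha>] by blast
        then show ?thesis
          using club(1)[OF \<alpha>] less_le_trans[OF x'(1)] by blast
      qed
      then show ?thesis
        using \<alpha>(2) unfolding limit_point_def by blast
    qed
    show "\<gamma> \<in> C \<alpha>" if "\<alpha> \<in> K" "is_limit \<alpha>" "\<gamma> \<sqsubset> \<alpha>" "limit_point (C \<alpha>) \<gamma>" for \<alpha> \<gamma>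
      using club(3)[OF that] .
    show "C \<gamma> = C \<alpha> \<inter> {x. x \<sqsubset> \<gamma>}"
      if \<alpha>: "\<alpha> \<in> K" "is_limit \<alpha>" and \<gamma>: "\<gamma> \<in> C \<alpha>" "limit_point (C \<alpha>) \<gamma>" for \<alpha> \<gamma>
    proof -
      have \<gamma>K: "\<gamma> \<in> K"
        using club(1)[OF \<alpha>] downward[OF \<alpha>(1)] \<gamma>(1) by blast
      moreover have "is_limit \<gamma>"
        using limit_point_mono[OF \<gamma>(2)] by simp
      ultimately have "C \<gamma> = C \<alpha> \<inter> underS \<kappa> \<gamma>"
        using C acc_K \<alpha> acc[OF \<gamma>K] \<gamma> unfolding square_seq_def by blast
      then show ?thesis
        by (simp add: underS[OF \<gamma>K])
    qed
  next
    fix D assume D: "D \<subseteq> K" "\<And>b. b \<in> K \<Longrightarrow> \<exists>x\<in>D. b \<sqsubset> x"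
      "\<And>\<gamma>. \<gamma> \<in> K \<Longrightarrow> limit_point D \<gamma> \<Longrightarrow> \<gamma> \<in> D"
    have "\<exists>\<gamma>\<in>D. (\<beta>, \<gamma>) \<in> \<kappa>" if "\<beta> \<in> K" for \<beta>
    proof -
      obtain \<gamma> where "\<gamma> \<in> D" "\<beta> \<sqsubset> \<gamma>"
        using D(2)[OF \<open>\<beta> \<in> K\<close>] by blast
      then show ?thesis
        using le[of \<gamma> \<beta>] D(1) less_imp_le by blast
    qed
    then have "club_in \<kappa> (Field \<kappa>) D"
      using D(1,3) limit_iff unfolding club_in_def \<kappa>(2)[symmetric] by blast
    then obtain \<gamma> where \<gamma>: "\<gamma> \<in> acc \<kappa> D" "D \<inter> underS \<kappa> \<gamma> \<noteq> C \<gamma>"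
      using C unfolding square_seq_def by blast
    moreover have "\<gamma> \<in> K"
      using \<gamma>(1) D(1) unfolding acc_def by blast
    ultimately show "\<exists>\<gamma>\<in>D. limit_point D \<gamma> \<and> D \<inter> {x. x \<sqsubset> \<gamma>} \<noteq> C \<gamma>"
      using acc underS by blast
  qed
qed

end

section \<open>The partial order\<close>

theorem theorem1p4:
  fixes \<kappa> :: "'a rel" and lam :: "'b rel"
  assumes "Card_order \<kappa>" and "natLeq <o \<kappa>" and "regularCard \<kappa>"
    and "square \<kappa>"
    and "Card_order lam" and "cinfinite lam" and "regularCard lam"
    and "lam <o \<kappa>"
  shows "\<exists>P :: 'a set rel. Partial_order P \<and>
    (\<forall>\<mu> :: 'b rel.
       Card_order \<mu> \<and> \<mu> <o lam \<and>
       (\<forall>\<nu> :: 'a rel. Card_order \<nu> \<and> \<nu> <o \<kappa> \<longrightarrow> \<nu> ^c \<mu> <o \<kappa>) \<longrightarrow>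
       knaster \<kappa> (full_power P \<mu>)) \<and>
    \<not> chain_condition \<kappa> (full_power P lam)"
proof -
  obtain leK ltK where K: "class.wellorder leK ltK"
    "\<And>x y. x \<in> Field \<kappa> \<Longrightarrow> leK y x \<longleftrightarrow> (y, x) \<in> \<kappa>"
    using initial_segment_of_wellorder[of \<kappa>] assms(1) card_order_on_well_order_on by blast
  obtain leL ltL where L: "class.wellorder leL ltL"
    "\<And>x y. x \<in> Field lam \<Longrightarrow> leL y x \<longleftrightarrow> (y, x) \<in> lam"
    using initial_segment_of_wellorder[of lam] assms(5) card_order_on_well_order_on by blast
  have \<kappa>_iso: "|Field \<kappa>| =o \<kappa>" and lam_iso: "|Field lam| =o lam"
    using assms card_of_Field_ordIso by blast+
  have "cinfinite \<kappa>"
    using assms(2) natLeq_cinfinite cinfinite_mono ordLess_imp_ordLeq by blast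
  then have infinite_\<kappa>: "infinite (Field \<kappa>)"
    unfolding cinfinite_def .
  have lam_less: "|Field lam| <o |Field \<kappa>|"
    using ordIso_ordLess_trans[OF lam_iso ordLess_ordIso_trans[OF assms(8) ordIso_symmetric[OF \<kappa>_iso]]] .
  interpret A: two_regular_cardinals leK ltK "Field \<kappa>" leL ltL "Field lam"
    by (intro two_regular_cardinals.intro two_regular_cardinals_axioms.intro regular_cardinal_Field
        K L assms lam_less \<open>cinfinite \<kappa>\<close>)
  obtain C where "square_seq \<kappa> C"
    using assms(4) unfolding square_def by blast
  then interpret B: square_sequence leK ltK "Field \<kappa>" leL ltL "Field lam" C
    using assms(1) card_order_on_well_order_on K(2) by (intro A.square_sequence_if_square_seq) blast+
  obtain D h where "coloured_ladder leK ltK (Field \<kappa>) leL ltL (Field lam) D h"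
  proof (rule B.coloured_ladder_exists)
    fix D h
    assume "\<And>\<alpha>. \<alpha> \<in> Field \<kappa> \<Longrightarrow> h \<alpha> \<in> Field lam"
      "\<And>i. i \<in> Field lam \<Longrightarrow> A.stationary {\<alpha>\<in>Field \<kappa>. ltL i (h \<alpha>)}"
      "\<And>\<alpha>. \<alpha> \<in> Field \<kappa> \<Longrightarrow> D \<alpha> \<subseteq> {x. ltK x \<alpha>}"
      "\<And>\<alpha> x. \<alpha> \<in> Field \<kappa> \<Longrightarrow> ltK x \<alpha> \<Longrightarrow> \<exists>y\<in>D \<alpha>. leK x y"
      "\<And>\<alpha> \<gamma>. \<alpha> \<in> Field \<kappa> \<Longrightarrow> ltK \<gamma> \<alpha> \<Longrightarrow> A.limit_point (D \<alpha>) \<gamma> \<Longrightarrow> \<gamma> \<in> D \<alpha>"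
      "\<And>\<alpha> \<gamma>. \<alpha> \<in> Field \<kappa> \<Longrightarrow> \<gamma> \<in> D \<alpha> \<Longrightarrow> A.limit_point (D \<alpha>) \<gamma> \<Longrightarrow> D \<gamma> = D \<alpha> \<inter> {x. ltK x \<gamma>}"
      "\<And>\<alpha> \<gamma>. \<alpha> \<in> Field \<kappa> \<Longrightarrow> \<gamma> \<in> D \<alpha> \<Longrightarrow> A.limit_point (D \<alpha>) \<gamma> \<Longrightarrow> h \<gamma> = h \<alpha>"
    then have "coloured_ladder leK ltK (Field \<kappa>) leL ltL (Field lam) D h"
      by unfold_locales
    then show thesis
      by (rule that)
  qed
  then interpret E: coloured_ladder leK ltK "Field \<kappa>" leL ltL "Field lam" D h .
  have "|Field lam \<times> Field \<kappa>| \<le>o |Field \<kappa>|"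
    using infinite_\<kappa> ordLess_imp_ordLeq[OF lam_less] card_of_mono1[OF subset_refl] card_of_Card_order
    by (intro card_of_Times_ordLeq_infinite_Field) (simp_all only: Field_card_of not_False_eq_True)
  then obtain code :: "'b \<times> 'a \<Rightarrow> 'a" where "inj_on code (Field lam \<times> Field \<kappa>)"
    using card_of_ordLeq[of "Field lam \<times> Field \<kappa>" "Field \<kappa>"] by blast
  then interpret F: coded_ladder leK ltK "Field \<kappa>" leL ltL "Field lam" D h code
    by unfold_locales
  have "knaster \<kappa> (full_power F.forcing \<mu>)"
    if \<mu>: "Card_order \<mu>" "\<mu> <o lam"
      and exp: "\<forall>\<nu> :: 'a rel. Card_order \<nu> \<and> \<nu> <o \<kappa> \<longrightarrow> \<nu> ^c \<mu> <o \<kappa>" for \<mu> :: "'b rel"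
  proof (rule F.power_knaster[OF \<kappa>_iso])
    show "|Field \<mu>| <o |Field lam|"
      using ordIso_ordLess_trans[OF card_of_Field_ordIso[OF \<mu>(1)]
          ordLess_ordIso_trans[OF \<mu>(2) ordIso_symmetric[OF lam_iso]]] .
    fix W :: "'a set set" assume W: "|W| <o |Field \<kappa>|"
    then obtain f where f: "inj_on f W" "f ` W \<subseteq> Field \<kappa>"
      using card_of_ordLeq[of W "Field \<kappa>"] ordLess_imp_ordLeq by blast
    have iso: "|W| =o |f ` W|"
      using f(1) card_of_ordIso inj_on_imp_bij_betw by blast
    have "|f ` W| <o \<kappa>"
      using ordIso_ordLess_trans[OF ordIso_symmetric[OF iso] ordLess_ordIso_trans[OF W \<kappa>_iso]] .
    then have "|f ` W| ^c \<mu> <o \<kappa>"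
      using exp card_of_Card_order by blast
    moreover have "|W| ^c \<mu> =o |f ` W| ^c \<mu>"
      using cexp_cong1[OF iso \<mu>(1)] .
    ultimately have "|W| ^c \<mu> <o |Field \<kappa>|"
      using ordIso_ordLess_trans ordLess_ordIso_trans[OF _ ordIso_symmetric[OF \<kappa>_iso]] by blast
    then show "|Func (Field \<mu>) W| <o |Field \<kappa>|"
      by (simp add: cexp_def Field_card_of)
  qed
  moreover have "\<not> chain_condition \<kappa> (full_power F.forcing lam)"
    by (rule F.power_not_chain_condition[OF \<kappa>_iso refl])
  ultimately show ?thesis
    using F.Partial_order_forcing by blast
qed

end
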